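(* Let $g \in L^2(\mathbb{R})$ be such that $1/Zg \notin L^2(Q)$, where $Q=[0,1)^2$ and $Z$ is the Zak transform. If there is some point $(x_0,\xi_0) \in Q$ such that $\rho_{x_0,\xi_0}/Zg \in L^2(Q)$, then the Gabor system $G(g,\mathbb{Z}^2)$ does not possess a reproducing partner in $L^2(\mathbb{R})$.
   Context: The Zak transform is the unitary map $Z:L^2(\mathbb{R})\to L^2(Q)$, $Zf(x,\xi)=\sum_{j\in\mathbb{Z}} f(x-j)\,e^{2\pi i j\xi}$ for $(x,\xi)\in Q$, where the series converges unconditionally in the norm of $L^2(Q)$. For $(x_0,\xi_0)\in Q$, $\rho_{x_0,\xi_0}(x,\xi)=\sqrt{(x-x_0)^2+(\xi-\xi_0)^2}$. The Gabor system is $G(g,\mathbb{Z}^2)=\{M_n T_k g\}_{(k,n)\in\mathbb{Z}^2}$, where $(M_n T_k g)(t)=e^{2\pi i n t}g(t-k)$. For a Hilbert space $\mathbb{H}$ (inner product linear in the first variable) and families $\Psi=\{\psi_i\}_{i\in I}$, $\Phi=\{\phi_i\}_{i\in I}$ in $\mathbb{H}$ with the same countable index set $I$, $(\Psi,\Phi)$ is a reproducing pair for $\mathbb{H}$, and $\Psi$ is a reproducing partner for $\Phi$, if there is a fixed ordering (enumeration) of $I$ such that, for all $f,g\in\mathbb{H}$, the partial sums of $\sum_{i\in I}\langle f,\psi_i\rangle\langle\phi_i,g\rangle$ converge with respect to that ordering, and the operator $S_{\Psi,\Phi}:\mathbb{H}\to\mathbb{H}$ weakly defined by $\langle S_{\Psi,\Phi}f,g\rangle=\sum_{i\in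 I}\langle f,\psi_i\rangle\langle\phi_i,g\rangle$ is bounded and boundedly invertible. *)

theory Defs
  imports "HOL-Analysis.Analysis"
begin

text \<open>
  The Hilbert space \<open>L\<^sup>2(M)\<close> is represented by square-integrable functions; equality of
  elements is equality almost everywhere. Over \<open>lborel\<close> the representatives are Borel
  functions; every class of Lebesgue measurable functions contains one.
\<close>

definition L2 :: "'a measure \<Rightarrow> ('a \<Rightarrow> complex) set" where
  "L2 M = {f \<in> borel_measurable M. integrable M (\<lambda>x. (cmod (f x))\<^sup>2)}"

definition L2_inner :: "'a measure \<Rightarrow> ('a \<Rightarrow> complex) \<Rightarrow> ('a \<Rightarrow> complex) \<Rightarrow> complex" where
  "L2_inner M f g = (LINT x|M. f x * cnj (g x))"

definition L2_norm :: "'a measure \<Rightarrow> ('a \<Rightarrow> complex) \<Rightarrow> real" where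
  "L2_norm M f = sqrt (LINT x|M. (cmod (f x))\<^sup>2)"

text \<open>
  Since \<open>a / 0 = 0\<close> in HOL, a quotient of functions is only regarded as an element of
  \<open>L\<^sup>2(M)\<close> if its denominator is nonzero almost everywhere.
\<close>

definition quotient_in_L2 :: "'a measure \<Rightarrow> ('a \<Rightarrow> complex) \<Rightarrow> ('a \<Rightarrow> complex) \<Rightarrow> bool" where
  "quotient_in_L2 M p q \<longleftrightarrow> (AE x in M. q x \<noteq> 0) \<and> (\<lambda>x. p x / q x) \<in> L2 M"

definition L2_bounded_operator ::
    "'a measure \<Rightarrow> (('a \<Rightarrow> complex) \<Rightarrow> ('a \<Rightarrow> complex)) \<Rightarrow> bool" where
  "L2_bounded_operator M S \<longleftrightarrow>
     (\<forall>f\<in>L2 M. S f \<in> L2 M) \<and>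
     (\<forall>f\<in>L2 M. \<forall>g\<in>L2 M. \<forall>a b. AE x in M.
        S (\<lambda>y. a * f y + b * g y) x = a * S f x + b * S g x) \<and>
     (\<exists>C. \<forall>f\<in>L2 M. L2_norm M (S f) \<le> C * L2_norm M f)"

definition L2_boundedly_invertible ::
    "'a measure \<Rightarrow> (('a \<Rightarrow> complex) \<Rightarrow> ('a \<Rightarrow> complex)) \<Rightarrow> bool" where
  "L2_boundedly_invertible M S \<longleftrightarrow>
     (\<exists>T. L2_bounded_operator M T \<and>
        (\<forall>f\<in>L2 M. (AE x in M. S (T f) x = f x) \<and> (AE x in M. T (S f) x = f x)))"

text \<open>
  Reproducing pairs for \<open>L\<^sup>2(M)\<close>, with families over a countable index set \<open>I\<close> and
  an enumeration \<open>e\<close> of \<open>I\<close>; a finite \<open>I\<close> is enumerated by \<open>0, \<dots>, card I - 1\<close>.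
\<close>

definition enumeration_dom :: "'i set \<Rightarrow> nat set" where
  "enumeration_dom I = (if finite I then {..<card I} else UNIV)"

definition reproducing_pair ::
    "'a measure \<Rightarrow> 'i set \<Rightarrow> ('i \<Rightarrow> 'a \<Rightarrow> complex) \<Rightarrow> ('i \<Rightarrow> 'a \<Rightarrow> complex) \<Rightarrow> bool" where
  "reproducing_pair M I \<Psi> \<Phi> \<longleftrightarrow>
     (\<forall>i\<in>I. \<Psi> i \<in> L2 M) \<and> (\<forall>i\<in>I. \<Phi> i \<in> L2 M) \<and>
     (\<exists>e. bij_betw e (enumeration_dom I) I \<and>
        (\<exists>S. (\<forall>f\<in>L2 M. \<forall>g\<in>L2 M.
               (\<lambda>n. \<Sum>k \<in> {..<n} \<inter> enumeration_dom I.
                  L2_inner M f (\<Psi> (e k)) * L2_inner M (\<Phi> (e k)) g)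
               \<longlonglongrightarrow> L2_inner M (S f) g) \<and>
             L2_bounded_operator M S \<and> L2_boundedly_invertible M S))"

definition translation :: "real \<Rightarrow> (real \<Rightarrow> complex) \<Rightarrow> real \<Rightarrow> complex" where
  "translation a f = (\<lambda>t. f (t - a))"

definition modulation :: "real \<Rightarrow> (real \<Rightarrow> complex) \<Rightarrow> real \<Rightarrow> complex" where
  "modulation b f = (\<lambda>t. cis (2 * pi * b * t) * f t)"

definition gabor_system :: "(real \<Rightarrow> complex) \<Rightarrow> int \<times> int \<Rightarrow> real \<Rightarrow> complex" where
  "gabor_system g = (\<lambda>(k, n). modulation (of_int n) (translation (of_int k) g))"

definition Q :: "(real \<times> real) set" where
  "Q = {0..<1} \<times> {0..<1}"

abbreviation Q_measure :: "(real \<times> real) measure" where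
  "Q_measure \<equiv> restrict_space lborel Q"

definition zak_sum :: "(real \<Rightarrow> complex) \<Rightarrow> int set \<Rightarrow> real \<times> real \<Rightarrow> complex" where
  "zak_sum f A = (\<lambda>(x, \<xi>). \<Sum>j\<in>A. f (x - of_int j) * cis (2 * pi * of_int j * \<xi>))"

text \<open>
  The Zak transform is the unconditional limit in \<open>L\<^sup>2(Q)\<close> of its series, i.e. the limit along
  the net of finite sets of indices; it is determined up to equality almost everywhere,
  and \<open>zak f\<close> is some representative.
\<close>

definition is_zak :: "(real \<Rightarrow> complex) \<Rightarrow> (real \<times> real \<Rightarrow> complex) \<Rightarrow> bool" where
  "is_zak f F \<longleftrightarrow> F \<in> L2 Q_measure \<and>
     ((\<lambda>A. L2_norm Q_measure (\<lambda>z. zak_sum f A z - F z)) \<longlongrightarrow> 0) (finite_subsets_at_top UNIV)"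

definition zak :: "(real \<Rightarrow> complex) \<Rightarrow> real \<times> real \<Rightarrow> complex" where
  "zak f = (SOME F. is_zak f F)"

definition rho :: "real \<times> real \<Rightarrow> real \<times> real \<Rightarrow> real" where
  "rho = (\<lambda>(x\<^sub>0, \<xi>\<^sub>0) (x, \<xi>). sqrt ((x - x\<^sub>0)\<^sup>2 + (\<xi> - \<xi>\<^sub>0)\<^sup>2))"

end

theory Submission
  imports Defs
begin

text \<open>
  Write \<open>G = Zg\<close>, \<open>\<phi>\<^bsub>k,n\<^esub> = M\<^sub>n T\<^sub>k g\<close> and \<open>e\<^sub>n(x) = cis (2 \<pi> n (x - x\<^sub>0))\<close>. Suppose that \<open>\<Psi>\<close> is a
  reproducing partner with operator \<open>S\<close>. The terms of the weakly convergent series tend to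
  \<open>0\<close>, so by two applications of the uniform boundedness principle, and since all \<open>\<phi>\<^bsub>k,n\<^esub>\<close>
  have the same norm, the norms of the \<open>\<psi>\<^bsub>k,n\<^esub>\<close> are bounded.

  Since \<open>\<bar>e\<^sub>n - 1\<bar>\<close> is at most a multiple of the distance to \<open>(x\<^sub>0, \<xi>\<^sub>0)\<close>, the quotient
  \<open>q\<^sub>n = (e\<^sub>n - 1) / cnj G\<close> is in \<open>L\<^sup>2(Q)\<close>, hence is the Zak transform of some \<open>h\<^sub>n\<close>. As the Zak
  transform turns \<open>\<phi>\<^bsub>k,n\<^esub>\<close> into a character times \<open>G\<close>, only the indices \<open>(0, n)\<close> and \<open>(0, 0)\<close>
  contribute to the series for \<open>\<langle>S f, h\<^sub>n\<rangle>\<close>, which is therefore bounded by a multiple of the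
  norm of \<open>f\<close>, uniformly in \<open>n\<close>. Taking \<open>f\<close> to be the preimage of \<open>h\<^sub>n\<close> under \<open>S\<close> bounds the
  norms of the \<open>q\<^sub>n\<close> uniformly in \<open>n\<close>. But the averages of \<open>\<bar>e\<^sub>n - 1\<bar>\<^sup>2\<close> over \<open>n < N\<close> tend to \<open>2\<close>
  wherever \<open>x \<noteq> x\<^sub>0\<close>, so Fatou's lemma gives \<open>1 / G \<in> L\<^sup>2(Q)\<close>.
\<close>

section \<open>The space of square-integrable functions\<close>

lemma borel_measurable_cnj [measurable (raw)]:
  "f \<in> borel_measurable M \<Longrightarrow> (\<lambda>x. cnj (f x)) \<in> borel_measurable M"
  by (rule borel_measurable_continuous_on[of cnj]) (auto intro: continuous_intros)

lemma L2D:
  assumes "f \<in> L2 M"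
  shows L2_measurable: "f \<in> borel_measurable M"
    and L2_integrable: "integrable M (\<lambda>x. (cmod (f x))\<^sup>2)"
  using assms by (auto simp: L2_def)

lemma L2_norm_nonneg: "0 \<le> L2_norm M f"
  by (simp add: L2_norm_def)

lemma L2_norm_power2: "(L2_norm M f)\<^sup>2 = (LINT x|M. (cmod (f x))\<^sup>2)"
  by (simp add: L2_norm_def)

lemma nn_integral_L2:
  assumes "f \<in> L2 M"
  shows "(\<integral>\<^sup>+x. ennreal ((cmod (f x))\<^sup>2) \<partial>M) = ennreal ((L2_norm M f)\<^sup>2)"
  unfolding L2_norm_power2
  by (rule nn_integral_eq_integral) (use L2_integrable[OF assms] in auto)

text \<open>Membership and the norm bound come together from an extended integral, which exists
  without prior integrability.\<close>

lemma L2_nn_integralI: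
  assumes [measurable]: "f \<in> borel_measurable M"
    and le: "(\<integral>\<^sup>+x. ennreal ((cmod (f x))\<^sup>2) \<partial>M) \<le> ennreal (c\<^sup>2)" and c: "0 \<le> c"
  shows "f \<in> L2 M" "L2_norm M f \<le> c"
proof -
  have "integrable M (\<lambda>x. (cmod (f x))\<^sup>2)"
  proof (rule integrableI_bounded)
    have "(\<integral>\<^sup>+x. ennreal (norm ((cmod (f x))\<^sup>2)) \<partial>M) \<le> ennreal (c\<^sup>2)"
      using le by simp
    also have "\<dots> < \<infinity>" by simp
    finally show "(\<integral>\<^sup>+x. ennreal (norm ((cmod (f x))\<^sup>2)) \<partial>M) < \<infinity>" .
  qed simp
  then show f: "f \<in> L2 M" by (simp add: L2_def)
  have "(L2_norm M f)\<^sup>2 \<le> c\<^sup>2"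
    using le by (simp add: nn_integral_L2[OF f])
  then show "L2_norm M f \<le> c"
    using c power2_le_imp_le by blast
qed

lemma L2_norm_cong_AE:
  assumes "f \<in> borel_measurable M" "g \<in> borel_measurable M" "AE x in M. f x = g x"
  shows "L2_norm M f = L2_norm M g"
  unfolding L2_norm_def
  by (rule arg_cong[where f=sqrt], rule integral_cong_AE) (use assms in auto)

lemma L2_inner_cong_AE:
  assumes "f \<in> borel_measurable M" "f' \<in> borel_measurable M" "g \<in> borel_measurable M"
    "AE x in M. f x = f' x"
  shows "L2_inner M f g = L2_inner M f' g"
proof -
  note [measurable] = assms(1-3)
  show ?thesis
    unfolding L2_inner_def by (rule integral_cong_AE) (use assms(4) in \<open>simp_all, auto\<close>)
qed

lemma L2_mult_cnj_integrable:
  assumes "f \<in> L2 M" "g \<in> L2 M"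
  shows "integrable M (\<lambda>x. f x * cnj (g x))"
proof (rule Bochner_Integration.integrable_bound)
  show "integrable M (\<lambda>x. (cmod (f x))\<^sup>2 + (cmod (g x))\<^sup>2)"
    using assms[THEN L2_integrable] by simp
  have "a * b \<le> a\<^sup>2 + b\<^sup>2" for a b :: real
  proof -
    have "2 * a * b \<le> a\<^sup>2 + b\<^sup>2" by (rule sum_squares_bound)
    moreover have "0 \<le> a\<^sup>2 + b\<^sup>2" by simp
    ultimately show ?thesis by linarith
  qed
  then show "AE x in M. norm (f x * cnj (g x)) \<le> norm ((cmod (f x))\<^sup>2 + (cmod (g x))\<^sup>2)"
    by (simp add: norm_mult)
  note [measurable] = assms[THEN L2_measurable]
  show "(\<lambda>x. f x * cnj (g x)) \<in> borel_measurable M" by measurable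
qed

lemma L2_zero [simp]: "(\<lambda>x. 0) \<in> L2 M"
  by (simp add: L2_def)

lemma L2_norm_zero [simp]: "L2_norm M (\<lambda>x. 0) = 0"
  by (simp add: L2_norm_def)

lemma L2_bounded_mult:
  assumes "f \<in> L2 M" and [measurable]: "u \<in> borel_measurable M"
    and u: "\<And>x. x \<in> space M \<Longrightarrow> cmod (u x) \<le> c"
  shows "(\<lambda>x. u x * f x) \<in> L2 M"
proof -
  note [measurable] = L2_measurable[OF assms(1)]
  have "integrable M (\<lambda>x. (cmod (u x * f x))\<^sup>2)"
  proof (rule Bochner_Integration.integrable_bound)
    show "integrable M (\<lambda>x. c\<^sup>2 * (cmod (f x))\<^sup>2)"
      using L2_integrable[OF assms(1)] by simp
    show "AE x in M. norm ((cmod (u x * f x))\<^sup>2) \<le> norm (c\<^sup>2 * (cmod (f x))\<^sup>2)"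
      by (rule AE_I2) (auto simp: norm_mult power_mult_distrib intro!: mult_right_mono power_mono u)
  qed simp
  then show ?thesis by (simp add: L2_def)
qed

lemma L2_cmult: "f \<in> L2 M \<Longrightarrow> (\<lambda>x. a * f x) \<in> L2 M"
  by (rule L2_bounded_mult[where c="cmod a"]) auto

lemma L2_add:
  assumes "f \<in> L2 M" "g \<in> L2 M"
  shows "(\<lambda>x. f x + g x) \<in> L2 M"
proof -
  note [measurable] = assms[THEN L2_measurable]
  have "integrable M (\<lambda>x. (cmod (f x + g x))\<^sup>2)"
  proof (rule Bochner_Integration.integrable_bound)
    show "integrable M (\<lambda>x. 2 * (cmod (f x))\<^sup>2 + 2 * (cmod (g x))\<^sup>2)"
      using assms[THEN L2_integrable] by simp
    have "(cmod (a + b))\<^sup>2 \<le> 2 * (cmod a)\<^sup>2 + 2 * (cmod b)\<^sup>2" for a b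
    proof -
      have "(cmod (a + b))\<^sup>2 \<le> (cmod a + cmod b)\<^sup>2"
        by (intro power_mono norm_triangle_ineq) simp
      moreover have "2 * cmod a * cmod b \<le> (cmod a)\<^sup>2 + (cmod b)\<^sup>2"
        by (rule sum_squares_bound)
      ultimately show ?thesis by (simp add: power2_sum)
    qed
    then show "AE x in M. norm ((cmod (f x + g x))\<^sup>2) \<le> norm (2 * (cmod (f x))\<^sup>2 + 2 * (cmod (g x))\<^sup>2)"
      by simp
  qed simp
  then show ?thesis by (simp add: L2_def)
qed

lemma L2_diff: "f \<in> L2 M \<Longrightarrow> g \<in> L2 M \<Longrightarrow> (\<lambda>x. f x - g x) \<in> L2 M"
  using L2_add[of f M "\<lambda>x. (-1) * g x"] L2_cmult[of g M "-1"] by simp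

lemma L2_sum: "(\<And>i. i \<in> A \<Longrightarrow> f i \<in> L2 M) \<Longrightarrow> (\<lambda>x. \<Sum>i\<in>A. f i x) \<in> L2 M"
  by (induction A rule: infinite_finite_induct) (auto intro: L2_add)

section \<open>The inner product, Cauchy-Schwarz and the triangle inequality\<close>

lemma L2_inner_commute: "L2_inner M f g = cnj (L2_inner M g f)"
proof -
  have "cnj (L2_inner M g f) = (LINT x|M. cnj (g x * cnj (f x)))"
    unfolding L2_inner_def by (rule Bochner_Integration.integral_cnj[symmetric])
  then show ?thesis by (simp add: L2_inner_def mult.commute)
qed

lemma L2_inner_add_left:
  assumes "f \<in> L2 M" "f' \<in> L2 M" "g \<in> L2 M"
  shows "L2_inner M (\<lambda>x. f x + f' x) g = L2_inner M f g + L2_inner M f' g"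
  unfolding L2_inner_def using assms by (simp add: distrib_right L2_mult_cnj_integrable)

lemma L2_inner_diff_left:
  assumes "f \<in> L2 M" "f' \<in> L2 M" "g \<in> L2 M"
  shows "L2_inner M (\<lambda>x. f x - f' x) g = L2_inner M f g - L2_inner M f' g"
  unfolding L2_inner_def using assms by (simp add: left_diff_distrib L2_mult_cnj_integrable)

lemma L2_inner_cmult_left: "L2_inner M (\<lambda>x. a * f x) g = a * L2_inner M f g"
  unfolding L2_inner_def by (simp add: mult.assoc)

lemma L2_inner_cmult_right: "L2_inner M f (\<lambda>x. a * g x) = cnj a * L2_inner M f g"
  unfolding L2_inner_def by (simp add: mult.left_commute)

lemma L2_inner_diff_right:
  assumes "f \<in> L2 M" "g \<in> L2 M" "g' \<in> L2 M"
  shows "L2_inner M f (\<lambda>x. g x - g' x) = L2_inner M f g - L2_inner M f g'"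
  using L2_inner_diff_left[OF assms(2,3,1)]
  by (metis L2_inner_commute complex_cnj_diff)

lemma L2_inner_sum_left:
  assumes "\<And>i. i \<in> A \<Longrightarrow> f i \<in> L2 M" "g \<in> L2 M"
  shows "L2_inner M (\<lambda>x. \<Sum>i\<in>A. f i x) g = (\<Sum>i\<in>A. L2_inner M (f i) g)"
  using assms
  by (induction A rule: infinite_finite_induct)
     (auto simp: L2_inner_add_left L2_sum L2_inner_def[of M "\<lambda>x. 0"])

lemma L2_inner_self: "L2_inner M f f = of_real ((L2_norm M f)\<^sup>2)"
  unfolding L2_norm_power2 L2_inner_def complex_norm_square[symmetric] of_real_power[symmetric]
  by (rule integral_complex_of_real)

text \<open>The inequality for extended integrals is applied to the moduli; replacing
  \<open><f, g>\<close> by the integral of \<open>|f| |g|\<close> only increases the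
  modulus.\<close>

lemma L2_Cauchy_Schwarz:
  assumes "f \<in> L2 M" "g \<in> L2 M"
  shows "cmod (L2_inner M f g) \<le> L2_norm M f * L2_norm M g"
proof -
  note [measurable] = assms[THEN L2_measurable]
  let ?I = "LINT x|M. cmod (f x) * cmod (g x)"
  have int: "integrable M (\<lambda>x. cmod (f x) * cmod (g x))"
    using integrable_norm[OF L2_mult_cnj_integrable[OF assms]] by (simp add: norm_mult)
  have "ennreal (?I\<^sup>2) = (\<integral>\<^sup>+x. ennreal (cmod (f x)) * ennreal (cmod (g x)) \<partial>M)\<^sup>2"
    using nn_integral_eq_integral[OF int]
    by (simp add: ennreal_mult power2_eq_square)
  also have "\<dots> \<le> (\<integral>\<^sup>+x. (ennreal (cmod (f x)))\<^sup>2 \<partial>M) * (\<integral>\<^sup>+x. (ennreal (cmod (g x)))\<^sup>2 \<partial>M)"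
    by (rule Cauchy_Schwarz_nn_integral) simp_all
  also have "\<dots> = ennreal ((L2_norm M f * L2_norm M g)\<^sup>2)"
    using nn_integral_L2[OF assms(1)] nn_integral_L2[OF assms(2)]
    by (simp add: ennreal_power power_mult_distrib ennreal_mult)
  finally have "?I\<^sup>2 \<le> (L2_norm M f * L2_norm M g)\<^sup>2"
    by simp
  then have "?I \<le> L2_norm M f * L2_norm M g"
    by (rule power2_le_imp_le) (simp add: L2_norm_nonneg)
  moreover have "cmod (L2_inner M f g) \<le> ?I"
    unfolding L2_inner_def
    using integral_norm_bound[of M "\<lambda>x. f x * cnj (g x)"] by (simp add: norm_mult)
  ultimately show ?thesis by linarith
qed

text \<open>Expanding the square leaves the cross term \<open>2 Re <f, g>\<close>, which
  Cauchy-Schwarz bounds.\<close>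

lemma L2_norm_triangle:
  assumes "f \<in> L2 M" "g \<in> L2 M"
  shows "L2_norm M (\<lambda>x. f x + g x) \<le> L2_norm M f + L2_norm M g"
proof (rule power2_le_imp_le)
  note fg = L2_add[OF assms]
  have "complex_of_real ((L2_norm M (\<lambda>x. f x + g x))\<^sup>2) =
      L2_inner M f (\<lambda>x. f x + g x) + L2_inner M g (\<lambda>x. f x + g x)"
    by (simp only: L2_inner_self[symmetric] L2_inner_add_left[OF assms fg])
  also have "\<dots> = cnj (L2_inner M (\<lambda>x. f x + g x) f) + cnj (L2_inner M (\<lambda>x. f x + g x) g)"
    by (metis L2_inner_commute)
  also have "\<dots> = L2_inner M f f + L2_inner M f g + cnj (L2_inner M f g) + L2_inner M g g"
    using L2_inner_add_left[OF assms assms(1)] L2_inner_add_left[OF assms assms(2)]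
      L2_inner_commute[of M f f] L2_inner_commute[of M g g] L2_inner_commute[of M g f]
    by simp
  also have "\<dots> = of_real ((L2_norm M f)\<^sup>2 + 2 * Re (L2_inner M f g) + (L2_norm M g)\<^sup>2)"
    by (simp add: L2_inner_self complex_eq_iff)
  finally have "(L2_norm M (\<lambda>x. f x + g x))\<^sup>2 = (L2_norm M f)\<^sup>2 + 2 * Re (L2_inner M f g) + (L2_norm M g)\<^sup>2"
    by (simp only: of_real_eq_iff)
  moreover have "Re (L2_inner M f g) \<le> L2_norm M f * L2_norm M g"
    using L2_Cauchy_Schwarz[OF assms] complex_Re_le_cmod[of "L2_inner M f g"] by linarith
  ultimately show "(L2_norm M (\<lambda>x. f x + g x))\<^sup>2 \<le> (L2_norm M f + L2_norm M g)\<^sup>2"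
    by (simp add: power2_sum)
qed (simp add: L2_norm_nonneg)

lemma L2_norm_cmult: "L2_norm M (\<lambda>x. a * f x) = cmod a * L2_norm M f"
  by (simp add: L2_norm_def norm_mult power_mult_distrib real_sqrt_mult)

lemma L2_norm_minus_commute: "L2_norm M (\<lambda>x. f x - g x) = L2_norm M (\<lambda>x. g x - f x)"
  by (simp add: L2_norm_def norm_minus_commute)

lemma L2_norm_diff_triangle:
  assumes "f \<in> L2 M" "g \<in> L2 M" "h \<in> L2 M"
  shows "L2_norm M (\<lambda>x. f x - h x) \<le> L2_norm M (\<lambda>x. f x - g x) + L2_norm M (\<lambda>x. g x - h x)"
  using L2_norm_triangle[OF L2_diff[OF assms(1,2)] L2_diff[OF assms(2,3)]] by simp

text \<open>Fatou's lemma for the squared moduli: norm bounds pass to almost everywhere limits. The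
  bound is asked for only from \<open>N\<close> on, as \<open>liminf\<close> ignores earlier
  terms.\<close>

lemma L2_Fatou:
  assumes meas: "\<And>n. F n \<in> borel_measurable M" "f \<in> borel_measurable M"
    and lim: "AE x in M. (\<lambda>n. F n x) \<longlonglongrightarrow> f x"
    and le: "\<And>n. n \<ge> N \<Longrightarrow> F n \<in> L2 M" "\<And>n. n \<ge> N \<Longrightarrow> L2_norm M (F n) \<le> c"
  shows "f \<in> L2 M" "L2_norm M f \<le> c"
proof -
  note [measurable] = meas
  have c: "0 \<le> c" using le(2)[of N] L2_norm_nonneg[of M "F N"] by simp
  have "(\<integral>\<^sup>+x. ennreal ((cmod (f x))\<^sup>2) \<partial>M) =
      (\<integral>\<^sup>+x. liminf (\<lambda>n. ennreal ((cmod (F n x))\<^sup>2)) \<partial>M)"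
  proof (rule nn_integral_cong_AE, use lim in eventually_elim)
    case (elim x)
    then have "(\<lambda>n. ennreal ((cmod (F n x))\<^sup>2)) \<longlonglongrightarrow> ennreal ((cmod (f x))\<^sup>2)"
      by (intro tendsto_intros)
    then show ?case
      using lim_imp_Liminf trivial_limit_sequentially by metis
  qed
  also have "\<dots> \<le> liminf (\<lambda>n. \<integral>\<^sup>+x. ennreal ((cmod (F n x))\<^sup>2) \<partial>M)"
    by (rule nn_integral_liminf) simp
  also have "\<dots> \<le> liminf (\<lambda>n::nat. ennreal (c\<^sup>2))"
  proof (rule Liminf_mono, rule eventually_sequentiallyI)
    fix n assume n: "N \<le> n"
    show "(\<integral>\<^sup>+x. ennreal ((cmod (F n x))\<^sup>2) \<partial>M) \<le> ennreal (c\<^sup>2)"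
      unfolding nn_integral_L2[OF le(1)[OF n]]
      by (intro ennreal_leI power_mono le(2) n L2_norm_nonneg)
  qed
  finally have le': "(\<integral>\<^sup>+x. ennreal ((cmod (f x))\<^sup>2) \<partial>M) \<le> ennreal (c\<^sup>2)"
    by (simp add: Liminf_const)
  show "f \<in> L2 M" "L2_norm M f \<le> c"
    using L2_nn_integralI[OF meas(2) le' c] by auto
qed

text \<open>The weights \<open>2\<^sup>n\<close> turn the square-integrability of the increments into pointwise
  summability of their squares at a geometric rate.\<close>

lemma L2_fast_Cauchy_AE_convergent:
  assumes F: "\<And>n. F n \<in> L2 M"
    and inc: "\<And>n. L2_norm M (\<lambda>x. F (Suc n) x - F n x) \<le> (1/2) ^ n"
  shows "AE x in M. convergent (\<lambda>n. F n x)"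
proof -
  define D where "D n x = F (Suc n) x - F n x" for n x
  have D: "D n \<in> L2 M" for n
    unfolding D_def using F by (intro L2_diff)
  note [measurable] = D[THEN L2_measurable]
  have "(\<integral>\<^sup>+x. (\<Sum>n. ennreal (2 ^ n * (cmod (D n x))\<^sup>2)) \<partial>M) =
      (\<Sum>n. \<integral>\<^sup>+x. ennreal (2 ^ n * (cmod (D n x))\<^sup>2) \<partial>M)"
    by (rule nn_integral_suminf) simp
  also have "\<dots> \<le> (\<Sum>n. ennreal ((1/2) ^ n))"
  proof (rule suminf_le)
    fix n
    have "(\<integral>\<^sup>+x. ennreal (2 ^ n * (cmod (D n x))\<^sup>2) \<partial>M) = ennreal (2 ^ n) * ennreal ((L2_norm M (D n))\<^sup>2)"
      by (simp add: ennreal_mult nn_integral_cmult nn_integral_L2[OF D])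
    also have "\<dots> = ennreal (2 ^ n * (L2_norm M (D n))\<^sup>2)"
      by (simp add: ennreal_mult)
    also have "\<dots> \<le> ennreal (2 ^ n * ((1/2) ^ n)\<^sup>2)"
      using inc[of n] by (intro ennreal_leI mult_left_mono power_mono L2_norm_nonneg) (auto simp: D_def[abs_def])
    also have "2 ^ n * ((1/2::real) ^ n)\<^sup>2 = (1/2) ^ n"
      by (simp add: power2_eq_square power_divide)
    finally show "(\<integral>\<^sup>+x. ennreal (2 ^ n * (cmod (D n x))\<^sup>2) \<partial>M) \<le> ennreal ((1/2) ^ n)" .
  qed auto
  also have "\<dots> = ennreal (\<Sum>n. (1/2) ^ n)"
    by (rule suminf_ennreal_eq) (auto intro: summable_sums summable_geometric)
  also have "\<dots> < \<infinity>" by simp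
  finally have "(\<integral>\<^sup>+x. (\<Sum>n. ennreal (2 ^ n * (cmod (D n x))\<^sup>2)) \<partial>M) \<noteq> \<infinity>"
    by simp
  then have "AE x in M. (\<Sum>n. ennreal (2 ^ n * (cmod (D n x))\<^sup>2)) \<noteq> \<infinity>"
    by (intro nn_integral_PInf_AE) simp_all
  then show ?thesis
  proof eventually_elim
    case (elim x)
    then have s: "summable (\<lambda>n. 2 ^ n * (cmod (D n x))\<^sup>2)"
      by (intro summable_suminf_not_top) auto
    have "summable (\<lambda>n. (1/2::real) ^ n + 2 ^ n * (cmod (D n x))\<^sup>2)"
      by (intro summable_add s) (simp add: summable_geometric)
    then have "summable (\<lambda>n. D n x)"
    proof (rule summable_comparison_test'[where N=0])
      fix n
      \<comment> \<open>This is \<open>2 a b \<le> a^2 + b^2\<close> with \<open>a = 1\<close> and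
        \<open>b = 2^n |D n x|\<close>, divided by \<open>2^n\<close>; it trades the modulus for a
        geometric term plus the weighted square.\<close>
      have "2 * (1 / 2 ^ n) * (2 ^ n * cmod (D n x)) \<le> (1/2^n) * 1 + (1 / 2^n) * (2 ^ n * cmod (D n x))\<^sup>2"
        using mult_left_mono[OF sum_squares_bound[of 1 "2 ^ n * cmod (D n x)"], of "1 / 2 ^ n"]
        by (simp add: algebra_simps)
      then have "2 * cmod (D n x) \<le> (1/2) ^ n + 2 ^ n * (cmod (D n x))\<^sup>2"
        by (simp add: power_divide power2_eq_square field_simps)
      then show "norm (D n x) \<le> (1/2) ^ n + 2 ^ n * (cmod (D n x))\<^sup>2"
        using norm_ge_zero[of "D n x"] by linarith
    qed
    then have "convergent (\<lambda>n. (\<Sum>i<n. D i x) + F 0 x)"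
      by (intro convergent_add convergent_const) (simp add: summable_iff_convergent)
    moreover have "(\<Sum>i<n. D i x) + F 0 x = F n x" for n
      using sum_lessThan_telescope[of "\<lambda>i. F i x" n] by (simp add: D_def)
    ultimately show ?case by simp
  qed
qed

text \<open>Riesz-Fischer: a subsequence with increments at most \<open>2^-k\<close> converges
  almost everywhere, and Fatou's lemma turns the Cauchy condition into norm convergence of the whole
  sequence to the pointwise limit.\<close>

lemma L2_complete:
  assumes F: "\<And>n. F n \<in> L2 M"
    and Cauchy: "\<And>e. e > 0 \<Longrightarrow> \<exists>N. \<forall>m\<ge>N. \<forall>n\<ge>N. L2_norm M (\<lambda>x. F m x - F n x) \<le> e"
  obtains f where "f \<in> L2 M" "(\<lambda>n. L2_norm M (\<lambda>x. F n x - f x)) \<longlonglongrightarrow> 0"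
proof -
  have "\<exists>N. \<forall>k. \<forall>m\<ge>N k. \<forall>n\<ge>N k. L2_norm M (\<lambda>x. F m x - F n x) \<le> (1/2) ^ k"
    using Cauchy by (intro choice) auto
  then obtain N where N: "\<And>k m n. m \<ge> N k \<Longrightarrow> n \<ge> N k \<Longrightarrow> L2_norm M (\<lambda>x. F m x - F n x) \<le> (1/2) ^ k"
    by metis
  \<comment> \<open>Summing the thresholds makes \<open>s\<close> monotone while keeping
    \<open>s k\<close> beyond \<open>N k\<close>.\<close>
  define s where "s k = (\<Sum>i\<le>k. N i) + k" for k
  have s: "N k \<le> s k" "k \<le> s k" "s k \<le> s (Suc k)" for k
    by (auto simp: s_def intro: trans_le_add1 member_le_sum)
  have s_mono: "mono s"
    using s(3) by (simp add: mono_iff_le_Suc)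
  have conv: "AE x in M. convergent (\<lambda>k. F (s k) x)"
  proof (rule L2_fast_Cauchy_AE_convergent)
    show "L2_norm M (\<lambda>x. F (s (Suc n)) x - F (s n) x) \<le> (1/2) ^ n" for n
      using s[of n] by (intro N) auto
  qed (rule F)
  define f where "f x = lim (\<lambda>k. F (s k) x)" for x
  note [measurable] = F[THEN L2_measurable]
  have [measurable]: "f \<in> borel_measurable M"
    unfolding f_def by measurable
  have lim: "AE x in M. (\<lambda>k. F (s k) x) \<longlonglongrightarrow> f x"
    using conv by eventually_elim (simp add: f_def convergent_LIMSEQ_iff)
  have bound: "(\<lambda>x. F n x - f x) \<in> L2 M \<and> L2_norm M (\<lambda>x. F n x - f x) \<le> (1/2) ^ k"
    if n: "n \<ge> N k" for n k
  proof -
    have "AE x in M. (\<lambda>j. F n x - F (s j) x) \<longlonglongrightarrow> F n x - f x"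
      using lim by eventually_elim (intro tendsto_intros)
    moreover have "L2_norm M (\<lambda>x. F n x - F (s j) x) \<le> (1/2) ^ k" if "j \<ge> k" for j
    proof (rule N[OF n])
      show "N k \<le> s j" using s(1)[of k] monoD[OF s_mono that] by linarith
    qed
    ultimately show ?thesis
      using L2_Fatou[of "\<lambda>j x. F n x - F (s j) x" M "\<lambda>x. F n x - f x" k "(1/2) ^ k"] F
      by (auto intro: L2_diff)
  qed
  \<comment> \<open>\<open>f\<close> itself is square-integrable, being the difference of
    \<open>F (N 0)\<close> and \<open>F (N 0) - f\<close>.\<close>
  have "(\<lambda>x. F (N 0) x - (F (N 0) x - f x)) \<in> L2 M"
    using L2_diff[OF F[of "N 0"] conjunct1[OF bound[of 0 "N 0"]]] by simp
  then have "f \<in> L2 M" by simp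
  moreover have "(\<lambda>n. L2_norm M (\<lambda>x. F n x - f x)) \<longlonglongrightarrow> 0"
  proof (rule LIMSEQ_I)
    fix r :: real assume r: "0 < r"
    then obtain k where k: "(1/2) ^ k < r"
      using real_arch_pow_inv[of r "1/2"] by auto
    have "norm (L2_norm M (\<lambda>x. F n x - f x) - 0) < r" if "n \<ge> N k" for n
      using bound[OF that] k L2_norm_nonneg[of M] by (simp add: abs_of_nonneg)
    then show "\<exists>no. \<forall>n\<ge>no. norm (L2_norm M (\<lambda>x. F n x - f x) - 0) < r"
      by blast
  qed
  ultimately show ?thesis by (rule that)
qed

text \<open>Writing \<open>F n = f + (F n - f)\<close> and likewise for \<open>G n\<close> leaves
  three error terms, each with a factor that tends to \<open>0\<close>.\<close>

lemma L2_inner_tendsto: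
  assumes f: "\<And>n. F n \<in> L2 M" "f \<in> L2 M" "((\<lambda>n. L2_norm M (\<lambda>x. F n x - f x)) \<longlongrightarrow> 0) A"
    and g: "\<And>n. G n \<in> L2 M" "g \<in> L2 M" "((\<lambda>n. L2_norm M (\<lambda>x. G n x - g x)) \<longlongrightarrow> 0) A"
  shows "((\<lambda>n. L2_inner M (F n) (G n)) \<longlongrightarrow> L2_inner M f g) A"
proof -
  let ?a = "\<lambda>n. L2_norm M (\<lambda>x. F n x - f x)" and ?b = "\<lambda>n. L2_norm M (\<lambda>x. G n x - g x)"
  have "((\<lambda>n. L2_inner M (F n) (G n) - L2_inner M f g) \<longlongrightarrow> 0) A"
  proof (rule Lim_null_comparison)
    show "((\<lambda>n. ?a n * ?b n + ?a n * L2_norm M g + L2_norm M f * ?b n) \<longlongrightarrow> 0) A"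
      using f(3) g(3) by (auto intro!: tendsto_eq_intros)
    have "norm (L2_inner M (F n) (G n) - L2_inner M f g) \<le>
        ?a n * ?b n + ?a n * L2_norm M g + L2_norm M f * ?b n" for n
    proof -
      have d: "(\<lambda>x. F n x - f x) \<in> L2 M" "(\<lambda>x. G n x - g x) \<in> L2 M"
        using f g by (auto intro: L2_diff)
      let ?A = "L2_inner M (\<lambda>x. F n x - f x) (\<lambda>x. G n x - g x)"
      let ?B = "L2_inner M (\<lambda>x. F n x - f x) g" and ?C = "L2_inner M f (\<lambda>x. G n x - g x)"
      have "L2_inner M (F n) (G n) - L2_inner M f g = ?A + ?B + ?C"
        using f g d by (simp add: L2_inner_diff_left L2_inner_diff_right)
      moreover have "norm (?A + ?B + ?C) \<le> norm ?A + norm ?B + norm ?C"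
        using norm_triangle_ineq[of "?A + ?B" ?C] norm_triangle_ineq[of ?A ?B] by linarith
      moreover have "norm ?A + norm ?B + norm ?C \<le> ?a n * ?b n + ?a n * L2_norm M g + L2_norm M f * ?b n"
        using f g d by (intro add_mono L2_Cauchy_Schwarz)
      ultimately show ?thesis by simp
    qed
    then show "\<forall>\<^sub>F n in A. norm (L2_inner M (F n) (G n) - L2_inner M f g) \<le>
        ?a n * ?b n + ?a n * L2_norm M g + L2_norm M f * ?b n" by simp
  qed
  then show ?thesis by (simp add: LIM_zero_iff)
qed

text \<open>A gliding hump: the \<open>n\<close>-th increment \<open>\<plusminus> 3\<^sup>-\<^sup>n u\<^sub>n\<close> of the test function makes the
  \<open>n\<close>-th functional large, and the later increments are too small to undo this.\<close>

lemma L2_uniform_boundedness: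
  assumes \<psi>: "\<And>i. \<psi> i \<in> L2 M"
    and bdd: "\<And>f. f \<in> L2 M \<Longrightarrow> \<exists>C. \<forall>i. cmod (L2_inner M f (\<psi> i)) \<le> C"
  shows "\<exists>C. \<forall>i. L2_norm M (\<psi> i) \<le> C"
proof (rule ccontr)
  assume "\<not> ?thesis"
  \<comment> \<open>The bound \<open>4^n\<close> beats the hump size \<open>3^-n\<close>, so the
    \<open>n\<close>-th hump contributes at least \<open>(4/3)^n\<close>.\<close>
  then have "\<exists>k. \<forall>n. L2_norm M (\<psi> (k n)) > 4 ^ n"
    by (intro choice) (meson not_less)
  then obtain k where k: "\<And>n. L2_norm M (\<psi> (k n)) > 4 ^ n"
    by blast
  have pos: "L2_norm M (\<psi> (k n)) > 0" for n
    using k[of n] zero_less_power[of 4 n] by (meson less_trans zero_less_numeral)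
  define u where "u n x = of_real (1 / L2_norm M (\<psi> (k n))) * \<psi> (k n) x" for n x
  have u: "u n \<in> L2 M" for n
    unfolding u_def using \<psi> by (intro L2_cmult)
  have u_norm: "L2_norm M (u n) = 1" for n
    unfolding u_def L2_norm_cmult using pos[of n] by (simp add: norm_divide)
  have u_inner: "L2_inner M (u n) (\<psi> (k n)) = of_real (L2_norm M (\<psi> (k n)))" for n
    unfolding u_def[abs_def] L2_inner_cmult_left L2_inner_self using pos[of n]
    by (simp add: power2_eq_square)
  \<comment> \<open>Step \<open>n\<close> adds the hump if that makes the \<open>n\<close>-th
    functional large, and subtracts it otherwise.\<close>
  define x where "x = rec_nat (\<lambda>t. 0)
    (\<lambda>n y. if cmod (L2_inner M (\<lambda>t. y t + of_real ((1/3)^n) * u n t) (\<psi> (k n)))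
                \<ge> (1/3)^n * L2_norm M (\<psi> (k n))
           then (\<lambda>t. y t + of_real ((1/3)^n) * u n t) else (\<lambda>t. y t - of_real ((1/3)^n) * u n t))"
  have x0: "x 0 = (\<lambda>t. 0)" by (simp add: x_def)
  have xSuc: "x (Suc n) = (if cmod (L2_inner M (\<lambda>t. x n t + of_real ((1/3)^n) * u n t) (\<psi> (k n)))
                \<ge> (1/3)^n * L2_norm M (\<psi> (k n))
           then (\<lambda>t. x n t + of_real ((1/3)^n) * u n t) else (\<lambda>t. x n t - of_real ((1/3)^n) * u n t))" for n
    by (simp add: x_def)
  have x: "x n \<in> L2 M" for n
    by (induction n) (auto simp: x0 xSuc intro!: L2_add L2_diff L2_cmult u)
  have inc: "L2_norm M (\<lambda>t. x (Suc n) t - x n t) = (1/3) ^ n" for n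
  proof -
    have "(\<lambda>t. x (Suc n) t - x n t) = (\<lambda>t. of_real ((1/3)^n) * u n t) \<or>
          (\<lambda>t. x (Suc n) t - x n t) = (\<lambda>t. (- of_real ((1/3)^n)) * u n t)"
      by (auto simp: xSuc)
    moreover have "L2_norm M (\<lambda>t. of_real ((1/3)^n) * u n t) = (1/3)^n"
      by (subst L2_norm_cmult) (simp add: u_norm norm_power norm_divide)
    moreover have "L2_norm M (\<lambda>t. (- of_real ((1/3)^n)) * u n t) = (1/3)^n"
      by (subst L2_norm_cmult) (simp add: u_norm norm_power norm_divide)
    ultimately show ?thesis by metis
  qed
  have large: "cmod (L2_inner M (x (Suc n)) (\<psi> (k n))) \<ge> (1/3)^n * L2_norm M (\<psi> (k n))" for n
  proof -
    let ?a = "L2_inner M (x n) (\<psi> (k n))" and ?b = "of_real ((1/3)^n * L2_norm M (\<psi> (k n))) :: complex"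
    have p: "L2_inner M (\<lambda>t. x n t + of_real ((1/3)^n) * u n t) (\<psi> (k n)) = ?a + ?b"
      using L2_inner_add_left[OF x L2_cmult[OF u] \<psi>]
      by (simp only: L2_inner_cmult_left u_inner of_real_mult)
    have m: "L2_inner M (\<lambda>t. x n t - of_real ((1/3)^n) * u n t) (\<psi> (k n)) = ?a - ?b"
      using L2_inner_diff_left[OF x L2_cmult[OF u] \<psi>]
      by (simp only: L2_inner_cmult_left u_inner of_real_mult)
    \<comment> \<open>\<open>2 b\<close> is the difference of \<open>a + b\<close> and
      \<open>a - b\<close>, so one of the two has modulus at least \<open>|b|\<close>: some sign
      always works.\<close>
    have "2 * cmod ?b = cmod ((?a + ?b) - (?a - ?b))"
      by (simp add: norm_mult)
    also have "\<dots> \<le> cmod (?a + ?b) + cmod (?a - ?b)"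
      by (rule norm_triangle_ineq4)
    finally have "cmod ?b \<le> cmod (?a + ?b) \<or> cmod ?b \<le> cmod (?a - ?b)"
      by linarith
    moreover have "cmod ?b = (1/3)^n * L2_norm M (\<psi> (k n))"
      by (simp only: norm_of_real abs_of_nonneg L2_norm_nonneg zero_le_mult_iff)
         (simp add: L2_norm_nonneg)
    ultimately show ?thesis
      by (auto simp only: xSuc p m split: if_split)
  qed
  \<comment> \<open>The increments are geometric; the exact partial sum, rather than its limit,
    makes the induction go through.\<close>
  have dist: "L2_norm M (\<lambda>t. x (n + j) t - x n t) \<le> 3/2 * (1/3) ^ n - 3/2 * (1/3) ^ (n + j)" for n j
  proof (induction j)
    case (Suc j)
    have "L2_norm M (\<lambda>t. x (n + Suc j) t - x n t) \<le>
        L2_norm M (\<lambda>t. x (Suc (n + j)) t - x (n + j) t) + L2_norm M (\<lambda>t. x (n + j) t - x n t)"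
      using L2_norm_diff_triangle[OF x[of "Suc (n + j)"] x[of "n + j"] x[of n]] by simp
    also have "\<dots> \<le> (1/3) ^ (n + j) + (3/2 * (1/3) ^ n - 3/2 * (1/3) ^ (n + j))"
      using Suc.IH inc[of "n + j"] by simp
    also have "\<dots> = 3/2 * (1/3) ^ n - 3/2 * (1/3) ^ (n + Suc j)"
      by simp
    finally show ?case .
  qed simp
  have dist': "L2_norm M (\<lambda>t. x m t - x n t) \<le> 3/2 * (1/3) ^ n" if "n \<le> m" for m n
  proof -
    have "0 \<le> (3/2 * (1/3) ^ m :: real)" by simp
    moreover have eq: "n + (m - n) = m" using that by simp
    ultimately show ?thesis
      using dist[of n "m - n", unfolded eq] by linarith
  qed
  obtain y where y: "y \<in> L2 M" "(\<lambda>n. L2_norm M (\<lambda>t. x n t - y t)) \<longlonglongrightarrow> 0"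
  proof (rule L2_complete[OF x])
    fix e :: real assume e: "e > 0"
    then obtain N where N: "(1/3::real) ^ N < e / 2"
      using real_arch_pow_inv[of "e/2" "1/3"] by auto
    have "L2_norm M (\<lambda>t. x m t - x n t) \<le> e" if "m \<ge> N" "n \<ge> N" for m n
    proof -
      have pw: "3/2 * (1/3) ^ i \<le> e" if "i \<ge> N" for i
      proof -
        have "(1/3::real) ^ i \<le> (1/3) ^ N" using that by (intro power_decreasing) auto
        then show ?thesis using N e by linarith
      qed
      show ?thesis
        using dist'[of n m] dist'[of m n] pw[OF that(1)] pw[OF that(2)]
          L2_norm_minus_commute[of M "x m" "x n"]
        by (cases "n \<le> m") auto
    qed
    then show "\<exists>N. \<forall>m\<ge>N. \<forall>n\<ge>N. L2_norm M (\<lambda>t. x m t - x n t) \<le> e" by blast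
  qed
  have tail: "L2_norm M (\<lambda>t. x n t - y t) \<le> 3/2 * (1/3) ^ n" for n
  proof (rule LIMSEQ_le_const)
    show "(\<lambda>m. 3/2 * (1/3) ^ n + L2_norm M (\<lambda>t. x m t - y t)) \<longlonglongrightarrow> 3/2 * (1/3) ^ n"
      using tendsto_add[OF tendsto_const y(2)] by simp
    have "L2_norm M (\<lambda>t. x n t - y t) \<le> 3/2 * (1/3) ^ n + L2_norm M (\<lambda>t. x m t - y t)" if "m \<ge> n" for m
      using L2_norm_diff_triangle[OF x[of n] x[of m] y(1)] dist'[OF that]
        L2_norm_minus_commute[of M "x m" "x n"] by simp
    then show "\<exists>N. \<forall>m\<ge>N. L2_norm M (\<lambda>t. x n t - y t) \<le> 3/2 * (1/3) ^ n + L2_norm M (\<lambda>t. x m t - y t)"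
      by blast
  qed
  \<comment> \<open>The limit differs from \<open>x (Suc n)\<close> by at most
    \<open>3/2 * 3^-(n+1) = 1/2 * 3^-n\<close>, so at most half of the \<open>n\<close>-th hump is
    destroyed.\<close>
  have big: "cmod (L2_inner M y (\<psi> (k n))) \<ge> 1/2 * (4/3) ^ n" for n
  proof -
    let ?N = "L2_norm M (\<psi> (k n))"
    have "L2_inner M y (\<psi> (k n)) = L2_inner M (x (Suc n)) (\<psi> (k n)) - L2_inner M (\<lambda>t. x (Suc n) t - y t) (\<psi> (k n))"
      using x y \<psi> by (simp add: L2_inner_diff_left)
    then have "cmod (L2_inner M y (\<psi> (k n))) \<ge>
        cmod (L2_inner M (x (Suc n)) (\<psi> (k n))) - cmod (L2_inner M (\<lambda>t. x (Suc n) t - y t) (\<psi> (k n)))"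
      by (metis norm_triangle_ineq2)
    moreover have "cmod (L2_inner M (\<lambda>t. x (Suc n) t - y t) (\<psi> (k n))) \<le> (3/2 * (1/3) ^ Suc n) * ?N"
      using L2_Cauchy_Schwarz[OF L2_diff[OF x[of "Suc n"] y(1)] \<psi>[of "k n"]]
        mult_right_mono[OF tail[of "Suc n"] L2_norm_nonneg[of M "\<psi> (k n)"]]
      by linarith
    moreover have "(3/2 * (1/3) ^ Suc n) * ?N = 1/2 * ((1/3) ^ n * ?N)" by simp
    moreover have "1/2 * ((1/3) ^ n * ?N) \<ge> 1/2 * ((1/3) ^ n * 4 ^ n)"
      using k[of n] by (intro mult_left_mono) auto
    moreover have "(1/3) ^ n * 4 ^ n = (4/3 :: real) ^ n"
      by (simp add: power_mult_distrib[symmetric])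
    ultimately show ?thesis using large[of n] by simp
  qed
  obtain C where C: "\<And>i. cmod (L2_inner M y (\<psi> i)) \<le> C"
    using bdd[OF y(1)] by blast
  obtain n where "2 * C < (4/3) ^ n"
    using real_arch_pow[of "4/3" "2 * C"] by auto
  then show False
    using big[of n] C[of "k n"] by simp
qed

section \<open>Uniqueness of Fourier coefficients on the torus\<close>

lemma integrable_bounded_mult:
  fixes w u :: "'a \<Rightarrow> complex"
  assumes w: "integrable M w" and [measurable]: "u \<in> borel_measurable M"
    and u: "\<And>x. x \<in> space M \<Longrightarrow> cmod (u x) \<le> B"
  shows "integrable M (\<lambda>x. w x * u x)"
proof (rule Bochner_Integration.integrable_bound)
  show "integrable M (\<lambda>x. B *\<^sub>R w x)" using w by simp
  show "AE x in M. norm (w x * u x) \<le> norm (B *\<^sub>R w x)"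
  proof (rule AE_I2)
    fix x assume x: "x \<in> space M"
    have "0 \<le> B" using u[OF x] norm_ge_zero[of "u x"] by linarith
    then show "norm (w x * u x) \<le> norm (B *\<^sub>R w x)"
      using mult_left_mono[OF u[OF x], of "cmod (w x)"] by (simp add: norm_mult mult.commute)
  qed
qed (use w in measurable)

text \<open>Closed sets form an intersection-stable generator of the Borel sets, so the vanishing
  extends to all Borel sets by Dynkin's argument; a density whose integrals all vanish is zero
  almost everywhere.\<close>

lemma AE_zero_if_closed_integrals_zero:
  fixes W :: "'a::topological_space \<Rightarrow> complex"
  assumes "sigma_finite_measure M" and M: "sets M = sets borel" and W: "integrable M W"
    and closed: "\<And>C. closed C \<Longrightarrow> (LINT x|M. W x * indicator C x) = 0"
  shows "AE x in M. W x = 0"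
proof (rule sigma_finite_measure.density_zero[OF assms(1) W])
  fix A assume A: "A \<in> sets M"
  have sp: "space M = UNIV" using sets_eq_imp_space_eq[OF M] by simp
  have set: "set_lebesgue_integral M B W = (LINT x|M. W x * indicator B x)" for B
    unfolding set_lebesgue_integral_def
    by (rule Bochner_Integration.integral_cong) (auto simp: indicator_def)
  have ssets: "sigma_sets UNIV (Collect closed) = sets M"
    unfolding M borel_eq_closed by (rule sets_measure_of[symmetric]) simp
  have sint: "set_integrable M B W" if "B \<in> sets M" for B
    unfolding set_integrable_def using W that by (intro integrable_mult_indicator)
  have "Int_stable (Collect closed :: 'a set set)"
    by (auto simp: Int_stable_def)
  moreover have "(Collect closed :: 'a set set) \<subseteq> Pow UNIV" by simp
  moreover have "A \<in> sigma_sets UNIV (Collect closed)" using A by (simp add: ssets)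
  ultimately show "set_lebesgue_integral M A W = 0"
  proof (induction A rule: sigma_sets_induct_disjoint)
    case (basic A)
    then show ?case using closed by (simp add: set)
  next
    case empty
    show ?case by (simp add: set_lebesgue_integral_def)
  next
    case (compl A)
    then have A: "A \<in> sets M" "UNIV - A \<in> sets M"
      using sets.compl_sets[of A M] by (auto simp: ssets sp)
    have "set_lebesgue_integral M (A \<union> (UNIV - A)) W =
        set_lebesgue_integral M A W + set_lebesgue_integral M (UNIV - A) W"
      by (rule set_integral_Un) (use sint A in auto)
    \<comment> \<open>The whole space is closed, so complements inherit the vanishing from the total
      integral.\<close>
    moreover have "set_lebesgue_integral M UNIV W = 0"
      using closed[of UNIV] by (simp only: set) simp
    ultimately show ?case using compl by simp
  next
    case (union A)
    then have A: "A i \<in> sets M" for i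
      by (auto simp: ssets)
    have "set_lebesgue_integral M (\<Union>i. A i) W = (\<Sum>i. set_lebesgue_integral M (A i) W)"
    proof (rule lebesgue_integral_countable_add)
      show "set_integrable M (\<Union>i. A i) W" using A by (intro sint) auto
      show "A i \<inter> A j = {}" if "i \<noteq> j" for i j
        using union(1) that by (auto simp: disjoint_family_on_def)
    qed (use A in auto)
    then show ?case using union by simp
  qed
qed

section \<open>Measures on the torus with vanishing Fourier coefficients\<close>

definition torus :: "(complex \<times> complex) set" where
  "torus = sphere 0 1 \<times> sphere 0 1"

lemma compact_torus: "compact torus"
  unfolding torus_def by (intro compact_Times) auto

text \<open>The complex measure \<open>w dM\<close>, carried to the torus by \<open>c\<close>, has
  only vanishing Fourier coefficients. The aim is that it vanishes on closed sets; everything is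
  expressed by integrals over \<open>M\<close>.\<close>

locale vanishing_moments =
  fixes M :: "'a measure" and w :: "'a \<Rightarrow> complex" and c :: "'a \<Rightarrow> complex \<times> complex"
  assumes w [measurable]: "integrable M w"
    and c [measurable]: "c \<in> M \<rightarrow>\<^sub>M borel"
    and torus: "\<And>x. c x \<in> torus"
    and moments: "\<And>m n. (LINT x|M. w x * (fst (c x) powi m * snd (c x) powi n)) = 0"
begin

lemma w_measurable [measurable]: "w \<in> borel_measurable M"
  using w by (rule borel_measurable_integrable)

lemma fst_snd_measurable [measurable]:
  "(\<lambda>x. fst (c x)) \<in> borel_measurable M" "(\<lambda>x. snd (c x)) \<in> borel_measurable M"
  using c by (auto intro!: borel_measurable_continuous_on[OF _ c] continuous_intros)

lemma norm_fst_snd: "cmod (fst (c x)) = 1" "cmod (snd (c x)) = 1"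
  using torus[of x] by (auto simp: torus_def mem_Times_iff)

lemma nonzero: "fst (c x) \<noteq> 0" "snd (c x) \<noteq> 0"
  using norm_fst_snd[of x] by auto

text \<open>Orthogonality to all characters, stated so that it is stable under multiplication by
  characters, and hence by polynomials in the coordinates of \<open>c\<close> and their conjugates.\<close>

definition orth :: "('a \<Rightarrow> complex) \<Rightarrow> bool" where
  "orth \<phi> \<longleftrightarrow> \<phi> \<in> borel_measurable M \<and> (\<exists>B. \<forall>x. cmod (\<phi> x) \<le> B) \<and>
     (\<forall>m n. (LINT x|M. w x * \<phi> x * (fst (c x) powi m * snd (c x) powi n)) = 0)"

lemma orthI:
  assumes "\<phi> \<in> borel_measurable M" "\<And>x. cmod (\<phi> x) \<le> B"
    "\<And>m n. (LINT x|M. w x * \<phi> x * (fst (c x) powi m * snd (c x) powi n)) = 0"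
  shows "orth \<phi>"
  using assms by (auto simp: orth_def)

lemma power_int_measurable [measurable]:
  "(\<lambda>x. fst (c x) powi m * snd (c x) powi n) \<in> borel_measurable M"
  unfolding power_int_def by measurable

lemma norm_character: "cmod (fst (c x) powi m * snd (c x) powi n) = 1"
  by (simp add: norm_mult norm_power_int norm_fst_snd)

lemma orth_integrable:
  assumes "orth \<phi>"
  shows "integrable M (\<lambda>x. w x * \<phi> x * (fst (c x) powi m * snd (c x) powi n))"
proof -
  obtain B where B: "\<And>x. cmod (\<phi> x) \<le> B" and [measurable]: "\<phi> \<in> borel_measurable M"
    using assms by (auto simp: orth_def)
  have "integrable M (\<lambda>x. w x * \<phi> x)"
    by (rule integrable_bounded_mult[OF w _ B]) measurable
  then show ?thesis
    by (rule integrable_bounded_mult[where B=1]) (auto simp: norm_character)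
qed

lemma orth_1: "orth (\<lambda>x. 1)"
  by (auto simp: orth_def moments intro: exI[of _ 1])

lemma orth_cmult: "orth \<phi> \<Longrightarrow> orth (\<lambda>x. a * \<phi> x)"
proof -
  assume \<phi>: "orth \<phi>"
  then obtain B where "\<And>x. cmod (\<phi> x) \<le> B" by (auto simp: orth_def)
  then have "cmod (a * \<phi> x) \<le> cmod a * B" for x
    by (simp add: norm_mult mult_left_mono)
  moreover have "w x * (a * \<phi> x) * z = a * (w x * \<phi> x * z)" for x z by simp
  then have "(LINT x|M. w x * (a * \<phi> x) * (fst (c x) powi m * snd (c x) powi n)) = 0" for m n
    using \<phi> by (simp only: integral_mult_right_zero) (simp add: orth_def)
  moreover have "(\<lambda>x. a * \<phi> x) \<in> borel_measurable M"
    using \<phi> by (auto simp: orth_def)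
  ultimately show ?thesis by (intro orthI)
qed

lemma orth_add:
  assumes "orth \<phi>" "orth \<psi>"
  shows "orth (\<lambda>x. \<phi> x + \<psi> x)"
proof -
  obtain B B' where "\<And>x. cmod (\<phi> x) \<le> B" "\<And>x. cmod (\<psi> x) \<le> B'"
    using assms by (auto simp: orth_def)
  then have "cmod (\<phi> x + \<psi> x) \<le> B + B'" for x
    by (meson add_mono norm_triangle_le)
  moreover have "(LINT x|M. w x * (\<phi> x + \<psi> x) * (fst (c x) powi m * snd (c x) powi n)) = 0" for m n
    unfolding distrib_left distrib_right
    by (subst Bochner_Integration.integral_add[OF orth_integrable[OF assms(1)] orth_integrable[OF assms(2)]])
       (use assms in \<open>simp add: orth_def\<close>)
  moreover have "(\<lambda>x. \<phi> x + \<psi> x) \<in> borel_measurable M"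
    using assms by (auto simp: orth_def)
  ultimately show ?thesis by (intro orthI)
qed

text \<open>Multiplication by a character only shifts the indices \<open>m\<close> and
  \<open>n\<close> of the vanishing moments.\<close>

lemma orth_character:
  assumes "orth \<phi>"
  shows "orth (\<lambda>x. fst (c x) powi k * snd (c x) powi l * \<phi> x)"
proof -
  obtain B where "\<And>x. cmod (\<phi> x) \<le> B"
    using assms by (auto simp: orth_def)
  then have "cmod (fst (c x) powi k * snd (c x) powi l * \<phi> x) \<le> B" for x
    using norm_character[of x k l] by (simp add: norm_mult)
  moreover have "w x * (fst (c x) powi k * snd (c x) powi l * \<phi> x) * (fst (c x) powi m * snd (c x) powi n)
      = w x * \<phi> x * (fst (c x) powi (k + m) * snd (c x) powi (l + n))" for x m n
    by (simp add: power_int_add nonzero)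
  then have "(LINT x|M. w x * (fst (c x) powi k * snd (c x) powi l * \<phi> x) * (fst (c x) powi m * snd (c x) powi n)) = 0" for m n
    using assms by (simp only:) (simp add: orth_def)
  moreover have "(\<lambda>x. fst (c x) powi k * snd (c x) powi l * \<phi> x) \<in> borel_measurable M"
    using assms by (intro borel_measurable_times[OF power_int_measurable]) (simp add: orth_def)
  ultimately show ?thesis by (intro orthI)
qed

text \<open>On the unit circle \<open>Re z\<close> and \<open>Im z\<close> are combinations of
  \<open>z\<close> and \<open>z^-1\<close>, so a real linear functional restricted to the torus is a
  combination of four characters.\<close>

lemma orth_linear:
  fixes f :: "complex \<times> complex \<Rightarrow> real"
  assumes f: "bounded_linear f" and \<phi>: "orth \<phi>"
  shows "orth (\<lambda>x. of_real (f (c x)) * \<phi> x)"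
proof -
  interpret f: bounded_linear f by (rule f)
  have Re_Im: "complex_of_real (Re z) = (z + z powi (-1)) / 2"
    "complex_of_real (Im z) = - \<i> * (z - z powi (-1)) / 2" if "cmod z = 1" for z
  proof -
    have "z * cnj z = 1" using that by (simp add: complex_norm_square[symmetric])
    then have "z powi (-1) = cnj z" by (simp add: power_int_minus inverse_unique)
    then show "complex_of_real (Re z) = (z + z powi (-1)) / 2"
      "complex_of_real (Im z) = - \<i> * (z - z powi (-1)) / 2"
      by (auto simp: complex_eq_iff)
  qed
  define a b a' b' where "a = f (1, 0)" and "b = f (\<i>, 0)" and "a' = f (0, 1)" and "b' = f (0, \<i>)"
  have split: "f z = Re (fst z) * a + Im (fst z) * b + Re (snd z) * a' + Im (snd z) * b'" for z
  proof -
    have "z = Re (fst z) *\<^sub>R (1, 0) + Im (fst z) *\<^sub>R (\<i>, 0) + Re (snd z) *\<^sub>R (0, 1) + Im (snd z) *\<^sub>R (0, \<i>)"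
      by (cases z) (auto simp: complex_eq_iff)
    then have "f z = f (Re (fst z) *\<^sub>R (1, 0) + Im (fst z) *\<^sub>R (\<i>, 0) + Re (snd z) *\<^sub>R (0, 1) + Im (snd z) *\<^sub>R (0, \<i>))"
      by simp
    then show ?thesis
      by (simp only: f.add f.scaleR a_def b_def a'_def b'_def real_scaleR_def)
  qed
  let ?e = "\<lambda>k l x. fst (c x) powi k * snd (c x) powi l * \<phi> x"
  have "of_real (f (c x)) * \<phi> x =
      (of_real a - \<i> * of_real b) / 2 * ?e 1 0 x + (of_real a + \<i> * of_real b) / 2 * ?e (-1) 0 x +
      (of_real a' - \<i> * of_real b') / 2 * ?e 0 1 x + (of_real a' + \<i> * of_real b') / 2 * ?e 0 (-1) x" for x
    unfolding split of_real_add of_real_mult Re_Im[OF norm_fst_snd(1)[of x]] Re_Im[OF norm_fst_snd(2)[of x]]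
    using nonzero[of x] by (simp add: field_simps power_int_minus)
  moreover have "orth (\<lambda>x. (of_real a - \<i> * of_real b) / 2 * ?e 1 0 x + (of_real a + \<i> * of_real b) / 2 * ?e (-1) 0 x +
      (of_real a' - \<i> * of_real b') / 2 * ?e 0 1 x + (of_real a' + \<i> * of_real b') / 2 * ?e 0 (-1) x)"
    by (intro orth_add orth_cmult orth_character \<phi>)
  ultimately show ?thesis by simp
qed

text \<open>Real polynomial functions arise from linear functionals and constants by sums and
  products; as \<open>\<phi>\<close> is arbitrary, a product acts as two successive
  multiplications.\<close>

lemma orth_polynomial:
  assumes "real_polynomial_function p" "orth \<phi>"
  shows "orth (\<lambda>x. of_real (p (c x)) * \<phi> x)"
  using assms
proof (induction arbitrary: \<phi>)
  case (linear f)
  then show ?case by (rule orth_linear)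
next
  case (const a)
  then show ?case by (rule orth_cmult)
next
  case (add f g)
  then show ?case
    using orth_add[OF add.IH(1)[OF add.prems] add.IH(2)[OF add.prems]] by (simp add: distrib_right)
next
  case (mult f g)
  then show ?case
    using mult.IH(1)[OF mult.IH(2)[OF mult.prems]] by (simp add: mult.assoc)
qed

text \<open>By Stone-Weierstrass \<open>F\<close> is a uniform limit of real polynomial functions on
  the compact torus, and these have vanishing integral against \<open>w\<close>.\<close>

lemma integral_continuous_zero:
  fixes F :: "complex \<times> complex \<Rightarrow> real"
  assumes F: "continuous_on UNIV F"
  shows "(LINT x|M. w x * of_real (F (c x))) = 0"
proof -
  have [measurable]: "(\<lambda>x. F (c x)) \<in> borel_measurable M"
    by (rule borel_measurable_continuous_on[OF F c])
  have Ft: "continuous_on torus F" using F continuous_on_subset by blast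
  obtain B where B: "\<And>z. z \<in> torus \<Longrightarrow> norm (F z) \<le> B"
    using compact_imp_bounded[OF compact_continuous_image[OF Ft compact_torus]]
    by (auto simp: bounded_iff)
  have int: "integrable M (\<lambda>x. w x * of_real (F (c x)))"
    by (rule integrable_bounded_mult[OF w, where B=B]) (use B torus in auto)
  have bound: "cmod (LINT x|M. w x * of_real (F (c x))) \<le> e * (LINT x|M. cmod (w x))" if e: "e > 0" for e
  proof -
    obtain p where p: "real_polynomial_function p" "\<And>z. z \<in> torus \<Longrightarrow> \<bar>F z - p z\<bar> < e"
      using Stone_Weierstrass_real_polynomial_function[OF compact_torus Ft e] by blast
    have orth: "orth (\<lambda>x. of_real (p (c x)))"
      using orth_polynomial[OF p(1) orth_1] by simp
    have intp: "integrable M (\<lambda>x. w x * of_real (p (c x)))"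
      using orth_integrable[OF orth, of 0 0] by simp
    have "(LINT x|M. w x * of_real (p (c x))) = 0"
      using orth unfolding orth_def by (auto dest!: spec[where x=0])
    then have "(LINT x|M. w x * of_real (F (c x))) =
        (LINT x|M. w x * of_real (F (c x)) - w x * of_real (p (c x)))"
      using int intp by simp
    also have "cmod \<dots> \<le> (LINT x|M. e * cmod (w x))"
    proof (rule order_trans[OF integral_norm_bound integral_mono])
      show "integrable M (\<lambda>x. norm (w x * of_real (F (c x)) - w x * of_real (p (c x))))"
        using int intp by (intro integrable_norm) simp
      show "integrable M (\<lambda>x. e * cmod (w x))" using w by simp
      fix x
      have "norm (w x * of_real (F (c x)) - w x * of_real (p (c x))) = cmod (w x) * \<bar>F (c x) - p (c x)\<bar>"
        by (simp only: right_diff_distrib[symmetric] of_real_diff[symmetric] norm_mult norm_of_real)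
      also have "\<dots> \<le> cmod (w x) * e"
        using p(2)[OF torus] by (intro mult_left_mono) (auto intro: less_imp_le)
      finally show "norm (w x * of_real (F (c x)) - w x * of_real (p (c x))) \<le> e * cmod (w x)"
        by (simp add: mult.commute)
    qed
    finally show ?thesis by simp
  qed
  define I where "I = (LINT x|M. cmod (w x))"
  have I: "0 \<le> I" by (simp add: I_def)
  have "cmod (LINT x|M. w x * of_real (F (c x))) \<le> 0 + e" if "e > 0" for e
  proof -
    \<comment> \<open>The \<open>1\<close> in the denominator guards against
      \<open>I = 0\<close>.\<close>
    have "cmod (LINT x|M. w x * of_real (F (c x))) \<le> e / (I + 1) * I"
      using bound[of "e / (I + 1)"] that I by (simp add: I_def[symmetric])
    also have "\<dots> \<le> e" using that I by (simp add: field_simps)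
    finally show ?thesis by simp
  qed
  then have "cmod (LINT x|M. w x * of_real (F (c x))) \<le> 0" by (rule field_le_epsilon)
  then show ?thesis by simp
qed

text \<open>The indicator of a closed set is the pointwise limit of the continuous tents
  \<open>max 0 (1 - n * infdist z C)\<close>, and dominated convergence applies. The empty set is
  treated apart since \<open>infdist\<close> to it is \<open>0\<close> by convention.\<close>

lemma integral_closed_zero:
  assumes C: "closed C"
  shows "(LINT x|M. w x * indicator C (c x)) = 0"
proof (cases "C = {}")
  case False
  define F where "F n z = max 0 (1 - real n * infdist z C)" for n z
  have F_cont: "continuous_on UNIV (F n)" for n
    unfolding F_def by (intro continuous_intros)
  have F_lim: "(\<lambda>n. F n z) \<longlonglongrightarrow> indicator C z" for z
  proof (cases "z \<in> C")
    case True
    then show ?thesis by (simp add: F_def)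
  next
    case z: False
    then have pos: "infdist z C > 0"
      using infdist_pos_not_in_closed[OF C False] by simp
    obtain N where N: "1 / infdist z C < real N" using reals_Archimedean2 by blast
    have "F n z = 0" if "n \<ge> N" for n
    proof -
      have "1 / infdist z C < real n" using N that by linarith
      then have "1 < real n * infdist z C" using pos by (simp add: field_simps)
      then show ?thesis by (simp add: F_def)
    qed
    then have "\<forall>\<^sub>F n in sequentially. F n z = 0"
      by (auto simp: eventually_sequentially)
    then show ?thesis using z by (simp add: tendsto_eventually)
  qed
  have [measurable]: "(\<lambda>x. F n (c x)) \<in> borel_measurable M" for n
    by (rule borel_measurable_continuous_on[OF F_cont c])
  have [measurable]: "C \<in> sets borel" using C by simp
  have "(\<lambda>n. LINT x|M. w x * of_real (F n (c x))) \<longlonglongrightarrow> (LINT x|M. w x * of_real (indicator C (c x)))"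
  proof (rule integral_dominated_convergence[where w="\<lambda>x. cmod (w x)"])
    show "AE x in M. (\<lambda>n. w x * of_real (F n (c x))) \<longlonglongrightarrow> w x * of_real (indicator C (c x))"
      by (rule AE_I2) (intro tendsto_intros F_lim)
    have "\<bar>F n z\<bar> \<le> 1" for n z
      by (simp add: F_def infdist_nonneg)
    then show "AE x in M. norm (w x * of_real (F n (c x))) \<le> cmod (w x)" for n
      by (intro AE_I2) (simp add: norm_mult mult_left_le)
  qed (use w in auto)
  then have "(LINT x|M. w x * of_real (indicator C (c x))) = 0"
    by (simp add: integral_continuous_zero[OF F_cont] LIMSEQ_const_iff)
  moreover have "complex_of_real (indicator C z) = indicator C z" for z
    by (auto simp: indicator_def)
  ultimately show ?thesis by simp
qed simp

end

section \<open>Uniqueness transferred from the torus to the unit square\<close>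

lemma cis_2pi_inj:
  assumes "x \<in> {0..<1}" "y \<in> {0..<1}" "cis (2 * pi * x) = cis (2 * pi * y)"
  shows "x = y"
proof -
  have "\<exists>n::int. 2 * pi * x = 2 * pi * y + 2 * pi * of_int n"
    using assms(3) sin_cos_eq_iff[of "2 * pi * x" "2 * pi * y"] by (simp add: complex_eq_iff)
  then obtain n :: int where "2 * pi * x = 2 * pi * (y + of_int n)"
    by (auto simp: distrib_left)
  then have "x = y + of_int n" by simp
  moreover from this assms(1,2) have "real_of_int n < 1" "real_of_int n > -1" by auto
  then have "n = 0" by linarith
  ultimately show ?thesis by simp
qed

lemma Q_sets [measurable]: "Q \<in> sets lborel" "Q \<in> sets borel"
proof -
  show "Q \<in> sets borel"
    unfolding Q_def borel_prod[symmetric] by measurable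
  then show "Q \<in> sets lborel" by simp
qed

text \<open>The exponential map \<open>c\<close> is injective on \<open>Q\<close>, but the image of
  \<open>C \<inter> Q\<close> for a closed set \<open>C\<close> need not be closed. Compact pieces
  have closed images, and they exhaust \<open>C \<inter> Q\<close>.\<close>

lemma torus_Fourier_unique:
  assumes w: "integrable Q_measure w"
    and mom: "\<And>m n. (LINT z|Q_measure. w z * (cis (2 * pi * of_int m * fst z) * cis (2 * pi * of_int n * snd z))) = 0"
  shows "AE z in Q_measure. w z = 0"
proof -
  \<comment> \<open>Extension by \<open>0\<close> to the plane, so that closed sets of the plane can
    be used as test sets.\<close>
  define W where "W z = indicator Q z *\<^sub>R w z" for z
  define c where "c z = (cis (2 * pi * fst z), cis (2 * pi * snd z))" for z :: "real \<times> real"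
  have W: "integrable lborel W"
    using w unfolding W_def by (simp add: integrable_restrict_space)
  note [measurable] = borel_measurable_integrable[OF W]
  have c_cont: "continuous_on A c" for A
    unfolding c_def cis_conv_exp by (intro continuous_intros)
  interpret vanishing_moments lborel W c
  proof
    show "c \<in> lborel \<rightarrow>\<^sub>M borel"
      by (simp add: borel_measurable_continuous_onI c_cont)
    show "c x \<in> torus" for x by (simp add: c_def torus_def)
    show "(LINT x|lborel. W x * (fst (c x) powi m * snd (c x) powi n)) = 0" for m n
    proof -
      have "(LINT x|lborel. W x * (fst (c x) powi m * snd (c x) powi n)) =
        (LINT z|lborel. indicator Q z *\<^sub>R (w z * (cis (2 * pi * of_int m * fst z) * cis (2 * pi * of_int n * snd z))))"
        unfolding W_def c_def fst_conv snd_conv cis_power_int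
        by (rule Bochner_Integration.integral_cong) (auto simp: mult_ac)
      also have "\<dots> = (LINT z|Q_measure. w z * (cis (2 * pi * of_int m * fst z) * cis (2 * pi * of_int n * snd z)))"
        by (rule integral_restrict_space[symmetric]) simp
      finally show ?thesis using mom by simp
    qed
  qed (rule W)
  have "AE z in lborel. W z = 0"
  proof (rule AE_zero_if_closed_integrals_zero[OF sigma_finite_lborel])
    fix C :: "(real \<times> real) set" assume C: "closed C"
    then have [measurable]: "C \<in> sets borel" by simp
    \<comment> \<open>The squares stay away from the sides that \<open>Q\<close> lacks, which makes
      \<open>K n\<close> a compact subset of \<open>Q\<close>.\<close>
    define K :: "nat \<Rightarrow> (real \<times> real) set" where "K n = C \<inter> ({0..1 - 1/(n+1)} \<times> {0..1 - 1/(n+1)})" for n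
    have "1 - 1 / (real n + 1) < 1" for n by simp
    then have KQ: "K n \<subseteq> Q" for n
      unfolding K_def Q_def by (fastforce intro: le_less_trans)
    have "compact (K n)" for n
      unfolding K_def by (intro closed_Int_compact C compact_Times) auto
    then have img: "closed (c ` K n)" for n
      by (intro compact_imp_closed compact_continuous_image c_cont)
    have [measurable]: "K n \<in> sets borel" for n
      using \<open>\<And>n. compact (K n)\<close> by (simp add: borel_closed compact_imp_closed)
    \<comment> \<open>Outside \<open>Q\<close> the factor \<open>W z\<close> is \<open>0\<close>;
      inside, injectivity of \<open>c\<close> identifies membership in the image with membership in
      \<open>K n\<close>.\<close>
    have "W z * indicator (c ` K n) (c z) = W z * indicator (K n) z" for n z
    proof (cases "z \<in> Q")
      case True
      have "z = z'" if "z' \<in> K n" "c z = c z'" for z'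
        using True KQ[of n] that
        by (auto simp: Q_def c_def prod_eq_iff intro!: cis_2pi_inj)
      then have "c z \<in> c ` K n \<longleftrightarrow> z \<in> K n" by auto
      then show ?thesis by (simp add: indicator_def)
    qed (simp add: W_def)
    then have zero: "(LINT z|lborel. W z * indicator (K n) z) = 0" for n
      using integral_closed_zero[OF img[of n]] by (simp only:)
    have "(\<lambda>n. LINT z|lborel. W z * indicator (K n) z) \<longlonglongrightarrow> (LINT z|lborel. W z * indicator C z)"
    proof (rule integral_dominated_convergence[where w="\<lambda>x. cmod (W x)"])
      show "AE z in lborel. (\<lambda>n. W z * indicator (K n) z) \<longlonglongrightarrow> W z * indicator C z"
      proof (rule AE_I2)
        fix z :: "real \<times> real"
        show "(\<lambda>n. W z * indicator (K n) z) \<longlonglongrightarrow> W z * indicator C z"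
        proof (cases "z \<in> Q")
          case True
          \<comment> \<open>\<open>d\<close> is the distance of \<open>z\<close> to the missing
            sides; once \<open>1/(n+1) < d\<close>, the point lies in the \<open>n\<close>-th
            square.\<close>
          define d where "d = min (1 - fst z) (1 - snd z)"
          have d: "d > 0" using True by (auto simp: d_def Q_def)
          obtain N where N: "inverse (real (Suc N)) < d" using reals_Archimedean[OF d] by blast
          have "indicator (K n) z = (indicator C z :: complex)" if "n \<ge> N" for n
          proof -
            have "1 / (real n + 1) \<le> inverse (real (Suc N))"
              using that by (simp add: field_simps)
            then have "1 / (real n + 1) < d" using N by linarith
            then show ?thesis
              using True by (auto simp: K_def Q_def d_def indicator_def)
          qed
          then have "\<forall>\<^sub>F n in sequentially. W z * indicator (K n) z = W z * indicator C z"
            by (auto simp: eventually_sequentially)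
          then show ?thesis by (rule tendsto_eventually)
        qed (simp add: W_def)
      qed
      show "AE z in lborel. norm (W z * indicator (K n) z) \<le> cmod (W z)" for n
        by (auto simp: indicator_def)
    qed (use W in auto)
    then show "(LINT z|lborel. W z * indicator C z) = 0"
      by (simp add: zero LIMSEQ_const_iff)
  qed (use W in auto)
  then show ?thesis
    by (subst AE_restrict_space_iff) (auto simp: W_def indicator_def)
qed

section \<open>Partial Fourier coefficients on the unit square\<close>

abbreviation U_measure :: "real measure" where
  "U_measure \<equiv> restrict_space lborel {0..<1}"

lemma space_U [simp]: "space U_measure = {0..<1}"
  by (simp add: space_restrict_space)

lemma emeasure_U: "emeasure U_measure {0..<1} = 1"
  by (subst emeasure_restrict_space) auto

interpretation U: finite_measure U_measure
  by (rule finite_measureI) (simp add: emeasure_U)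

interpretation UU: pair_sigma_finite U_measure U_measure ..

text \<open>Makes Fubini's theorem available on \<open>Q\<close>. A product of sigma-finite measures
  is determined by its values on rectangles, where planar Lebesgue measure factors.\<close>

lemma Q_measure_eq_pair: "Q_measure = U_measure \<Otimes>\<^sub>M U_measure"
proof (rule pair_measure_eqI[symmetric])
  show "sigma_finite_measure U_measure" "sigma_finite_measure U_measure"
    by (rule U.sigma_finite_measure_axioms)+
  have U_sets: "A \<in> sets borel" "A \<subseteq> {0..<1}" if "A \<in> sets U_measure" for A
    using that by (auto simp: sets_restrict_space_iff)
  show "sets (U_measure \<Otimes>\<^sub>M U_measure) = sets Q_measure"
  proof (rule antisym)
    have "{a \<times> b | a b. a \<in> sets U_measure \<and> b \<in> sets U_measure} \<subseteq> sets Q_measure"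
    proof clarify
      fix A B assume AB: "A \<in> sets U_measure" "B \<in> sets U_measure"
      then have [measurable]: "A \<in> sets borel" "B \<in> sets borel" using U_sets by auto
      have "A \<times> B \<in> sets borel" unfolding borel_prod[symmetric] by measurable
      moreover have "A \<times> B \<subseteq> Q"
        using U_sets(2)[OF AB(1)] U_sets(2)[OF AB(2)] by (auto simp: Q_def)
      ultimately show "A \<times> B \<in> sets Q_measure"
        by (simp add: sets_restrict_space_iff Q_sets)
    qed
    then have "sigma_sets (space Q_measure) {a \<times> b | a b. a \<in> sets U_measure \<and> b \<in> sets U_measure} \<subseteq> sets Q_measure"
      by (rule sets.sigma_sets_subset)
    then show "sets (U_measure \<Otimes>\<^sub>M U_measure) \<subseteq> sets Q_measure"
      unfolding sets_pair_measure by (simp add: space_restrict_space Q_def)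
    show "sets Q_measure \<subseteq> sets (U_measure \<Otimes>\<^sub>M U_measure)"
    proof
      fix X assume "X \<in> sets Q_measure"
      then obtain Y where Y: "Y \<in> sets borel" "X = Q \<inter> Y"
        by (auto simp: sets_restrict_space)
      have id: "(\<lambda>x. x) \<in> U_measure \<rightarrow>\<^sub>M borel"
        by (rule measurable_restrict_space1) simp
      have "(\<lambda>z. (fst z, snd z)) \<in> U_measure \<Otimes>\<^sub>M U_measure \<rightarrow>\<^sub>M borel \<Otimes>\<^sub>M borel"
        by (intro measurable_Pair measurable_compose[OF measurable_fst id] measurable_compose[OF measurable_snd id])
      then have "(\<lambda>z. z) -` Y \<inter> space (U_measure \<Otimes>\<^sub>M U_measure) \<in> sets (U_measure \<Otimes>\<^sub>M U_measure)"
        using Y(1) by (intro measurable_sets[where A=borel]) (simp_all add: borel_prod)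
      then show "X \<in> sets (U_measure \<Otimes>\<^sub>M U_measure)"
        using Y by (simp add: space_pair_measure Q_def Int_commute)
    qed
  qed
  fix A B assume AB: "A \<in> sets U_measure" "B \<in> sets U_measure"
  have "A \<times> B \<subseteq> Q"
    using U_sets(2)[OF AB(1)] U_sets(2)[OF AB(2)] by (auto simp: Q_def)
  then have "emeasure Q_measure (A \<times> B) = emeasure (lborel \<Otimes>\<^sub>M lborel) (A \<times> B)"
    unfolding lborel_prod by (simp add: emeasure_restrict_space Q_sets)
  also have "\<dots> = emeasure lborel A * emeasure lborel B"
    by (rule lborel.emeasure_pair_measure_Times) (use AB U_sets in auto)
  also have "\<dots> = emeasure U_measure A * emeasure U_measure B"
    using U_sets(2)[OF AB(1)] U_sets(2)[OF AB(2)] by (simp add: emeasure_restrict_space)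
  finally show "emeasure U_measure A * emeasure U_measure B = emeasure Q_measure (A \<times> B)" ..
qed

lemma space_Q [simp]: "space Q_measure = Q"
  by (simp add: space_restrict_space)

interpretation QM: finite_measure Q_measure
  unfolding Q_measure_eq_pair
proof (rule finite_measureI)
  have "emeasure (U_measure \<Otimes>\<^sub>M U_measure) ({0..<1} \<times> {0..<1}) = 1"
    by (subst U.emeasure_pair_measure_Times) (auto simp: emeasure_U sets_restrict_space_iff)
  then show "emeasure (U_measure \<Otimes>\<^sub>M U_measure) (space (U_measure \<Otimes>\<^sub>M U_measure)) \<noteq> \<infinity>"
    by (simp add: space_pair_measure)
qed

lemma id_U_measurable: "(\<lambda>x. x) \<in> U_measure \<rightarrow>\<^sub>M borel"
  by (rule measurable_restrict_space1) simp

lemma fst_snd_Q_measurable [measurable]: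
  "fst \<in> Q_measure \<rightarrow>\<^sub>M U_measure" "snd \<in> Q_measure \<rightarrow>\<^sub>M U_measure"
  unfolding Q_measure_eq_pair by measurable

lemma cis_measurable [measurable (raw)]:
  "f \<in> borel_measurable M \<Longrightarrow> (\<lambda>x. cis (f x)) \<in> borel_measurable M"
  by (rule borel_measurable_continuous_on[of cis]) (auto simp: cis_conv_exp intro!: continuous_intros)

lemma borel_measurable_U:
  assumes "f \<in> borel_measurable borel"
  shows "f \<in> borel_measurable U_measure"
  by (rule measurable_restrict_space1) (use assms in simp)

lemma cis_U_measurable [measurable]:
  "(\<lambda>x. cis (c * x)) \<in> borel_measurable U_measure"
  by (rule borel_measurable_U) simp

lemma L2_mult_fst_cis:
  assumes "a \<in> L2 U_measure"
  shows "(\<lambda>z. a (fst z) * cis (2 * pi * of_int j * snd z)) \<in> L2 Q_measure"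
proof (rule L2_nn_integralI)
  note [measurable] = L2_measurable[OF assms]
  show "(\<lambda>z. a (fst z) * cis (2 * pi * of_int j * snd z)) \<in> borel_measurable Q_measure"
    by measurable
  have "(\<integral>\<^sup>+z. ennreal ((cmod (a (fst z) * cis (2 * pi * of_int j * snd z)))\<^sup>2) \<partial>Q_measure) =
      (\<integral>\<^sup>+z. ennreal ((cmod (a (fst z)))\<^sup>2) \<partial>(U_measure \<Otimes>\<^sub>M U_measure))"
    unfolding Q_measure_eq_pair by (simp add: norm_mult)
  also have "\<dots> = (\<integral>\<^sup>+x. \<integral>\<^sup>+y. ennreal ((cmod (a x))\<^sup>2) \<partial>U_measure \<partial>U_measure)"
    by (subst U.nn_integral_fst[symmetric]) simp_all
  also have "\<dots> = ennreal ((L2_norm U_measure a)\<^sup>2)"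
    by (simp add: emeasure_U nn_integral_L2[OF assms])
  finally show "(\<integral>\<^sup>+z. ennreal ((cmod (a (fst z) * cis (2 * pi * of_int j * snd z)))\<^sup>2) \<partial>Q_measure)
      \<le> ennreal ((L2_norm U_measure a)\<^sup>2)" by simp
qed (rule L2_norm_nonneg)

text \<open>The Fourier coefficient in the second variable only, as a function of the first. For a
  Zak transform \<open>q = Zf\<close> it recovers the piece \<open>f(x - j)\<close>.\<close>

definition coef :: "(real \<times> real \<Rightarrow> complex) \<Rightarrow> int \<Rightarrow> real \<Rightarrow> complex" where
  "coef q j x = (LINT \<xi>|U_measure. q (x, \<xi>) * cnj (cis (2 * pi * of_int j * \<xi>)))"

lemma L2_cis_U: "(\<lambda>x. cis (2 * pi * of_int j * x)) \<in> L2 U_measure"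
  by (simp add: L2_def)

lemma L2_norm_cis_U: "L2_norm U_measure (\<lambda>x. cis (2 * pi * of_int j * x)) = 1"
  by (simp add: L2_norm_def measure_def emeasure_U)

lemma pair_Q_measurable:
  assumes "q \<in> borel_measurable Q_measure"
  shows "q \<in> borel_measurable (U_measure \<Otimes>\<^sub>M U_measure)"
  using assms by (simp add: Q_measure_eq_pair)

lemma coef_measurable [measurable]:
  assumes "q \<in> borel_measurable Q_measure"
  shows "coef q j \<in> borel_measurable U_measure"
proof -
  note [measurable] = pair_Q_measurable[OF assms]
  show ?thesis
    unfolding coef_def[abs_def] by measurable
qed

text \<open>By Fubini almost every section of \<open>q\<close> is square-integrable; Cauchy-Schwarz
  against a character of norm \<open>1\<close> bounds the coefficient by the norm of the
  section.\<close>

lemma L2_coef: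
  assumes q: "q \<in> L2 Q_measure"
  shows "coef q j \<in> L2 U_measure"
proof -
  note [measurable] = pair_Q_measurable[OF L2_measurable[OF q]]
  have int: "integrable (U_measure \<Otimes>\<^sub>M U_measure) (\<lambda>z. (cmod (q z))\<^sup>2)"
    using L2_integrable[OF q] by (simp add: Q_measure_eq_pair)
  have "integrable U_measure (\<lambda>x. (cmod (coef q j x))\<^sup>2)"
  proof (rule Bochner_Integration.integrable_bound)
    show "integrable U_measure (\<lambda>x. LINT \<xi>|U_measure. (cmod (q (x, \<xi>)))\<^sup>2)"
      using UU.integrable_fst'[OF int] .
    show "AE x in U_measure. norm ((cmod (coef q j x))\<^sup>2) \<le> norm (LINT \<xi>|U_measure. (cmod (q (x, \<xi>)))\<^sup>2)"
      using UU.AE_integrable_fst'[OF int] AE_space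
    proof eventually_elim
      case (elim x)
      then have "(\<lambda>\<xi>. q (x, \<xi>)) \<in> L2 U_measure"
        unfolding L2_def by simp
      then have "cmod (coef q j x) \<le> L2_norm U_measure (\<lambda>\<xi>. q (x, \<xi>))"
        using L2_Cauchy_Schwarz[OF _ L2_cis_U[of j], of "\<lambda>\<xi>. q (x, \<xi>)"]
        by (simp add: coef_def L2_inner_def L2_norm_cis_U)
      then have "(cmod (coef q j x))\<^sup>2 \<le> (L2_norm U_measure (\<lambda>\<xi>. q (x, \<xi>)))\<^sup>2"
        by (intro power_mono) auto
      then show ?case by (simp add: L2_norm_power2)
    qed
  qed (use L2_measurable[OF q] in measurable)
  then show ?thesis
    using coef_measurable[OF L2_measurable[OF q]] by (simp add: L2_def)
qed

text \<open>By Fubini, taking the \<open>j\<close>-th coefficient is adjoint to multiplying a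
  function of \<open>x\<close> by the \<open>j\<close>-th character in \<open>\<xi>\<close>.\<close>

lemma L2_inner_fst_cis:
  assumes a: "a \<in> L2 U_measure" and q: "q \<in> L2 Q_measure"
  shows "L2_inner Q_measure (\<lambda>z. a (fst z) * cis (2 * pi * of_int j * snd z)) q =
    L2_inner U_measure a (coef q j)"
proof -
  have int: "integrable (U_measure \<Otimes>\<^sub>M U_measure) (\<lambda>z. a (fst z) * cis (2 * pi * of_int j * snd z) * cnj (q z))"
    using L2_mult_cnj_integrable[OF L2_mult_fst_cis[OF a] q] by (simp add: Q_measure_eq_pair)
  have "L2_inner Q_measure (\<lambda>z. a (fst z) * cis (2 * pi * of_int j * snd z)) q =
      (LINT x|U_measure. LINT \<xi>|U_measure. a x * cis (2 * pi * of_int j * \<xi>) * cnj (q (x, \<xi>)))"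
    unfolding L2_inner_def using UU.integral_fst'[OF int] by (simp add: Q_measure_eq_pair)
  also have "\<dots> = (LINT x|U_measure. a x * cnj (coef q j x))"
  proof (rule Bochner_Integration.integral_cong[OF refl])
    fix x
    have "cnj (coef q j x) = (LINT \<xi>|U_measure. cnj (q (x, \<xi>) * cnj (cis (2 * pi * of_int j * \<xi>))))"
      unfolding coef_def by (rule Bochner_Integration.integral_cnj[symmetric])
    then show "(LINT \<xi>|U_measure. a x * cis (2 * pi * of_int j * \<xi>) * cnj (q (x, \<xi>))) = a x * cnj (coef q j x)"
      by (simp add: mult.assoc mult.commute[of "cnj (q _)"])
  qed
  finally show ?thesis by (simp add: L2_inner_def)
qed

section \<open>Orthogonality of characters and trigonometric sums in the second variable\<close>

lemma integral_cis_U: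
  "(LINT x|U_measure. cis (2 * pi * of_int k * x)) = (if k = 0 then 1 else 0)"
proof (cases "k = 0")
  case True
  then show ?thesis by (simp add: measure_def emeasure_U)
next
  case False
  define F where "F x = cis (2 * pi * of_int k * x) / (2 * pi * of_int k * \<i>)" for x
  have "(LINT x|U_measure. cis (2 * pi * of_int k * x)) =
      (LINT x|lborel. indicator {0..<1} x *\<^sub>R cis (2 * pi * of_int k * x))"
    by (rule integral_restrict_space) simp
  \<comment> \<open>Adding the null endpoint \<open>1\<close> gives the closed interval of the
    fundamental theorem of calculus.\<close>
  also have "\<dots> = (LINT x|lborel. indicator {0..1} x *\<^sub>R cis (2 * pi * of_int k * x))"
  proof (rule integral_cong_AE)
    show "AE x in lborel. indicator {0..<1} x *\<^sub>R cis (2 * pi * of_int k * x) =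
        indicator {0..1} x *\<^sub>R cis (2 * pi * of_int k * x)"
      using AE_lborel_singleton[of "1::real"] by eventually_elim (auto simp: indicator_def)
  qed simp_all
  also have "\<dots> = F 1 - F 0"
  proof (rule integral_FTC_Icc)
    show "(F has_vector_derivative cis (2 * pi * of_int k * x)) (at x within {0..1})" for x
      unfolding F_def cis_conv_exp using False
      by (auto intro!: derivative_eq_intros has_vector_derivative_real_field simp: scaleR_conv_of_real)
    show "continuous_on {0..1} (\<lambda>x. cis (2 * pi * of_int k * x))"
      unfolding cis_conv_exp by (intro continuous_intros)
  qed simp
  also have "\<dots> = 0"
    by (simp add: F_def)
  finally show ?thesis using False by simp
qed

text \<open>For finite \<open>A\<close>, a trigonometric polynomial in \<open>\<xi>\<close> whose
  coefficients are functions of \<open>x\<close>; partial sums of the Zak series are the case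
  \<open>a j x = f(x - j)\<close>.\<close>

definition trig_sum :: "(int \<Rightarrow> real \<Rightarrow> complex) \<Rightarrow> int set \<Rightarrow> real \<times> real \<Rightarrow> complex" where
  "trig_sum a A z = (\<Sum>j\<in>A. a j (fst z) * cis (2 * pi * of_int j * snd z))"

lemma zak_sum_eq_trig_sum: "zak_sum f A = trig_sum (\<lambda>j x. f (x - of_int j)) A"
  by (auto simp: zak_sum_def trig_sum_def fun_eq_iff)

lemma L2_trig_sum: "(\<And>j. j \<in> A \<Longrightarrow> a j \<in> L2 U_measure) \<Longrightarrow> trig_sum a A \<in> L2 Q_measure"
  unfolding trig_sum_def[abs_def] by (intro L2_sum L2_mult_fst_cis)

lemma coef_trig_sum:
  assumes "finite A"
  shows "coef (trig_sum a A) j x = (if j \<in> A then a j x else 0)"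
proof -
  have "coef (trig_sum a A) j x = (LINT \<xi>|U_measure. (\<Sum>l\<in>A. a l x * cis (2 * pi * of_int (l - j) * \<xi>)))"
    unfolding coef_def trig_sum_def sum_distrib_right
    by (intro Bochner_Integration.integral_cong sum.cong)
       (auto simp: cis_cnj mult.assoc cis_mult algebra_simps)
  also have "\<dots> = (\<Sum>l\<in>A. a l x * (LINT \<xi>|U_measure. cis (2 * pi * of_int (l - j) * \<xi>)))"
    by (subst Bochner_Integration.integral_sum) (auto intro!: integrable_mult_right U.integrable_const_bound[where B=1])
  also have "\<dots> = (\<Sum>l\<in>A. if l = j then a l x else 0)"
    unfolding integral_cis_U by (intro sum.cong) auto
  finally show ?thesis using assms by simp
qed

lemma L2_inner_trig_sum_left:
  assumes "\<And>j. j \<in> A \<Longrightarrow> a j \<in> L2 U_measure" "q \<in> L2 Q_measure"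
  shows "L2_inner Q_measure (trig_sum a A) q = (\<Sum>j\<in>A. L2_inner U_measure (a j) (coef q j))"
proof -
  have "L2_inner Q_measure (trig_sum a A) q =
      (\<Sum>j\<in>A. L2_inner Q_measure (\<lambda>z. a j (fst z) * cis (2 * pi * of_int j * snd z)) q)"
    unfolding trig_sum_def[abs_def] using assms by (intro L2_inner_sum_left L2_mult_fst_cis)
  also have "\<dots> = (\<Sum>j\<in>A. L2_inner U_measure (a j) (coef q j))"
    using assms by (intro sum.cong refl L2_inner_fst_cis)
  finally show ?thesis .
qed

lemma L2_inner_trig_sum:
  assumes A: "finite A" and a: "\<And>j. j \<in> A \<Longrightarrow> a j \<in> L2 U_measure" and b: "\<And>j. j \<in> A \<Longrightarrow> b j \<in> L2 U_measure"
  shows "L2_inner Q_measure (trig_sum a A) (trig_sum b A) = (\<Sum>j\<in>A. L2_inner U_measure (a j) (b j))"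
proof -
  have "L2_inner U_measure (a j) (coef (trig_sum b A) j) = L2_inner U_measure (a j) (b j)" if "j \<in> A" for j
    using that A by (simp add: L2_inner_def coef_trig_sum)
  then show ?thesis
    using L2_inner_trig_sum_left[OF a L2_trig_sum[OF b]] by simp
qed

section \<open>The Zak transform\<close>

lemma L2_shift_U:
  assumes "f \<in> L2 lborel"
  shows "(\<lambda>x. f (x - of_int j)) \<in> L2 U_measure"
proof -
  have [measurable]: "f \<in> borel_measurable borel"
    using L2_measurable[OF assms] by simp
  have "(\<lambda>x. f (x - of_int j)) \<in> borel_measurable U_measure"
    by (rule borel_measurable_U) measurable
  moreover have "integrable lborel (\<lambda>x. (cmod (f (- of_int j + 1 * x)))\<^sup>2)"
    by (rule lborel_integrable_real_affine[OF L2_integrable[OF assms]]) simp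
  then have "integrable lborel (\<lambda>x. indicator {0..<1} x *\<^sub>R (cmod (f (x - of_int j)))\<^sup>2)"
    by (intro integrable_mult_indicator) simp_all
  then have "integrable U_measure (\<lambda>x. (cmod (f (x - of_int j)))\<^sup>2)"
    by (subst integrable_restrict_space) auto
  ultimately show ?thesis by (simp add: L2_def)
qed

text \<open>The union of the intervals \<open>[-j, 1 - j)\<close> over \<open>j\<close> in
  \<open>A\<close>. The minus sign matches the arguments \<open>x - j\<close> of the Zak series for
  \<open>x\<close> in \<open>[0, 1)\<close>.\<close>

definition strip :: "int set \<Rightarrow> real set" where
  "strip A = {t. - \<lfloor>t\<rfloor> \<in> A}"

lemma strip_measurable [measurable]: "strip A \<in> sets borel"
proof -
  have "strip A = (\<lambda>t. \<lfloor>t\<rfloor>) -` (uminus ` A) \<inter> space borel"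
    by (auto simp: strip_def image_iff) (metis minus_minus)
  also have "\<dots> \<in> sets borel"
    by (rule measurable_sets[OF measurable_real_floor]) simp
  finally show ?thesis .
qed

lemma indicator_strip_shift:
  "indicator (strip {j}) (x - of_int j) = (indicator {0..<1::real} x :: 'a :: zero_neq_one)"
proof -
  have "- \<lfloor>x - of_int j\<rfloor> = j \<longleftrightarrow> \<lfloor>x\<rfloor> = 0" by auto
  also have "\<dots> \<longleftrightarrow> x \<in> {0..<1}" by (auto simp: floor_eq_iff)
  finally show ?thesis by (simp add: strip_def indicator_def)
qed

lemma indicator_strip_sum:
  assumes "finite A"
  shows "indicator (strip A) t = (\<Sum>j\<in>A. indicator (strip {j}) t :: 'a :: {comm_semiring_1})"
  using assms by (simp add: strip_def indicator_def)

text \<open>The substitution \<open>t = x - j\<close> carries the unit interval to the interval with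
  index \<open>j\<close>.\<close>

lemma integral_strip:
  fixes F :: "real \<Rightarrow> complex"
  assumes F: "integrable lborel F" and A: "finite A"
  shows "(LINT t|lborel. indicator (strip A) t *\<^sub>R F t) = (\<Sum>j\<in>A. LINT x|U_measure. F (x - of_int j))"
proof -
  have "(LINT x|U_measure. F (x - of_int j)) = (LINT t|lborel. indicator (strip {j}) t *\<^sub>R F t)" for j
  proof -
    have "(LINT t|lborel. indicator (strip {j}) t *\<^sub>R F t) =
        \<bar>1\<bar> *\<^sub>R (LINT x|lborel. indicator (strip {j}) (- of_int j + 1 * x) *\<^sub>R F (- of_int j + 1 * x))"
      by (rule lborel_integral_real_affine) simp
    also have "\<dots> = (LINT x|lborel. indicator {0..<1} x *\<^sub>R F (x - of_int j))"
      by (simp add: indicator_strip_shift)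
    also have "\<dots> = (LINT x|U_measure. F (x - of_int j))"
      by (rule integral_restrict_space[symmetric]) simp
    finally show ?thesis ..
  qed
  moreover have "integrable lborel (\<lambda>t. indicator (strip {j}) t *\<^sub>R F t)" for j
    using F by (intro integrable_mult_indicator) simp_all
  ultimately show ?thesis
    by (simp add: indicator_strip_sum[OF A] scaleR_sum_left Bochner_Integration.integral_sum)
qed

lemma nn_integral_strip:
  fixes F :: "real \<Rightarrow> ennreal"
  assumes [measurable]: "F \<in> borel_measurable borel" and A: "finite A"
  shows "(\<integral>\<^sup>+t. indicator (strip A) t * F t \<partial>lborel) = (\<Sum>j\<in>A. \<integral>\<^sup>+x. F (x - of_int j) \<partial>U_measure)"
proof -
  have "(\<integral>\<^sup>+x. F (x - of_int j) \<partial>U_measure) = (\<integral>\<^sup>+t. indicator (strip {j}) t * F t \<partial>lborel)" for j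
  proof -
    have "(\<integral>\<^sup>+t. indicator (strip {j}) t * F t \<partial>lborel) =
        ennreal \<bar>1\<bar> * (\<integral>\<^sup>+x. indicator (strip {j}) (- of_int j + 1 * x) * F (- of_int j + 1 * x) \<partial>lborel)"
      by (rule nn_integral_real_affine) simp_all
    also have "\<dots> = (\<integral>\<^sup>+x. F (x - of_int j) * indicator {0..<1} x \<partial>lborel)"
      by (simp add: indicator_strip_shift mult.commute)
    also have "\<dots> = (\<integral>\<^sup>+x. F (x - of_int j) \<partial>U_measure)"
      by (rule nn_integral_restrict_space[symmetric]) simp
    finally show ?thesis ..
  qed
  then show ?thesis
    by (simp add: indicator_strip_sum[OF A] sum_distrib_right nn_integral_sum)
qed

lemma L2_zak_sum: "f \<in> L2 lborel \<Longrightarrow> zak_sum f A \<in> L2 Q_measure"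
  unfolding zak_sum_eq_trig_sum by (intro L2_trig_sum L2_shift_U)

text \<open>Orthogonality in \<open>\<xi>\<close> removes the mixed terms; the diagonal ones
  reassemble the inner product over the intervals with index in \<open>A\<close>.\<close>

lemma L2_inner_zak_sum:
  assumes f: "f \<in> L2 lborel" and h: "h \<in> L2 lborel" and A: "finite A"
  shows "L2_inner Q_measure (zak_sum f A) (zak_sum h A) =
    (LINT t|lborel. indicator (strip A) t *\<^sub>R (f t * cnj (h t)))"
  unfolding zak_sum_eq_trig_sum
  using L2_inner_trig_sum[OF A L2_shift_U[OF f] L2_shift_U[OF h]]
    integral_strip[OF L2_mult_cnj_integrable[OF f h] A]
  by (simp add: L2_inner_def)

lemma L2_norm_zak_sum:
  assumes f: "f \<in> L2 lborel" and A: "finite A"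
  shows "(L2_norm Q_measure (zak_sum f A))\<^sup>2 = (LINT t|lborel. indicator (strip A) t *\<^sub>R (cmod (f t))\<^sup>2)"
proof -
  have "complex_of_real ((L2_norm Q_measure (zak_sum f A))\<^sup>2) =
      (LINT t|lborel. complex_of_real (indicator (strip A) t *\<^sub>R (cmod (f t))\<^sup>2))"
    unfolding L2_inner_self[symmetric] L2_inner_zak_sum[OF f f A]
    by (intro Bochner_Integration.integral_cong)
       (auto simp: indicator_def complex_norm_square simp del: of_real_power)
  then show ?thesis
    unfolding integral_complex_of_real of_real_eq_iff .
qed

section \<open>Convergence of the Zak series and the isometry property\<close>

lemma zak_sum_diff:
  "finite A \<Longrightarrow> B \<subseteq> A \<Longrightarrow> zak_sum f A z - zak_sum f B z = zak_sum f (A - B) z"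
  by (simp add: zak_sum_eq_trig_sum trig_sum_def sum_diff)

text \<open>A cofinal sequence of finite index sets: limits along the net in \<open>is_zak\<close>
  can be computed along it, so that sequential completeness and dominated convergence apply.\<close>

definition zint :: "nat \<Rightarrow> int set" where
  "zint n = {- int n..int n}"

lemma finite_zint [simp]: "finite (zint n)"
  by (simp add: zint_def)

lemma zint_mono: "m \<le> n \<Longrightarrow> zint m \<subseteq> zint n"
  by (auto simp: zint_def)

lemma eventually_in_zint: "\<forall>\<^sub>F n in sequentially. j \<in> zint n"
  by (rule eventually_sequentiallyI[of "nat \<bar>j\<bar>"]) (auto simp: zint_def)

lemma indicator_strip_zint_tendsto:
  "(\<lambda>n. indicator (strip (zint n)) t :: 'a :: {zero_neq_one, topological_space}) \<longlonglongrightarrow> 1"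
  by (rule tendsto_eventually)
     (use eventually_in_zint[of "- \<lfloor>t\<rfloor>"] in eventually_elim, simp add: strip_def)

lemma filterlim_zint: "filterlim zint (finite_subsets_at_top UNIV) sequentially"
  unfolding filterlim_finite_subsets_at_top
proof safe
  fix X :: "int set" assume X: "finite X"
  have "\<forall>\<^sub>F n in sequentially. \<forall>j\<in>X. j \<in> zint n"
    using X eventually_in_zint by (intro eventually_ball_finite) auto
  then show "\<forall>\<^sub>F n in sequentially. finite (zint n) \<and> X \<subseteq> zint n \<and> zint n \<subseteq> UNIV"
    by eventually_elim auto
qed

lemma is_zak_sequence:
  assumes "is_zak f F"
  shows "(\<lambda>n. L2_norm Q_measure (\<lambda>z. zak_sum f (zint n) z - F z)) \<longlonglongrightarrow> 0"
  using assms filterlim_compose[OF _ filterlim_zint] unfolding is_zak_def by blast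

text \<open>A partial sum over indices outside \<open>zint n\<close> has at most the norm of
  \<open>f\<close> off the corresponding intervals, which tends to \<open>0\<close>. This tail bound
  gives both the Cauchy property along \<open>zint\<close> and convergence along the whole
  net.\<close>

lemma is_zak_exists:
  assumes f: "f \<in> L2 lborel"
  obtains F where "is_zak f F"
proof -
  have [measurable]: "f \<in> borel_measurable borel"
    using L2_measurable[OF f] by simp
  note int = L2_integrable[OF f]
  define tail where "tail n = sqrt (LINT t|lborel. indicator (- strip (zint n)) t *\<^sub>R (cmod (f t))\<^sup>2)" for n
  have "(\<lambda>n. LINT t|lborel. indicator (- strip (zint n)) t *\<^sub>R (cmod (f t))\<^sup>2) \<longlonglongrightarrow> (LINT t|(lborel :: real measure). 0)"
  proof (rule integral_dominated_convergence[where w="\<lambda>t. (cmod (f t))\<^sup>2"])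
    show "AE t in lborel. (\<lambda>n. indicator (- strip (zint n)) t *\<^sub>R (cmod (f t))\<^sup>2) \<longlonglongrightarrow> 0"
    proof (rule AE_I2)
      fix t
      have "(\<lambda>n. (1 - indicator (strip (zint n)) t) *\<^sub>R (cmod (f t))\<^sup>2) \<longlonglongrightarrow> (1 - 1) *\<^sub>R (cmod (f t))\<^sup>2"
        by (intro tendsto_intros indicator_strip_zint_tendsto)
      then show "(\<lambda>n. indicator (- strip (zint n)) t *\<^sub>R (cmod (f t))\<^sup>2) \<longlonglongrightarrow> 0"
        by (simp add: indicator_compl)
    qed
    show "AE t in lborel. norm (indicator (- strip (zint n)) t *\<^sub>R (cmod (f t))\<^sup>2) \<le> (cmod (f t))\<^sup>2" for n
      by (auto simp: indicator_def)
  qed (use int in auto)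
  then have tail0: "tail \<longlonglongrightarrow> 0"
    unfolding tail_def[abs_def] using tendsto_real_sqrt by fastforce
  have tail: "L2_norm Q_measure (\<lambda>z. zak_sum f A z - zak_sum f (zint n) z) \<le> tail n"
    if "finite A" "zint n \<subseteq> A" for A n
  proof -
    have "(L2_norm Q_measure (zak_sum f (A - zint n)))\<^sup>2 =
        (LINT t|lborel. indicator (strip (A - zint n)) t *\<^sub>R (cmod (f t))\<^sup>2)"
      using that by (intro L2_norm_zak_sum f) simp
    also have "\<dots> \<le> (LINT t|lborel. indicator (- strip (zint n)) t *\<^sub>R (cmod (f t))\<^sup>2)"
      using int by (intro integral_mono integrable_mult_indicator) (auto simp: indicator_def strip_def)
    finally have "L2_norm Q_measure (zak_sum f (A - zint n)) \<le> tail n"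
      unfolding tail_def by (rule real_le_rsqrt)
    then show ?thesis using that by (simp add: zak_sum_diff)
  qed
  have zak_L2: "zak_sum f A \<in> L2 Q_measure" for A
    by (rule L2_zak_sum[OF f])
  obtain F where F: "F \<in> L2 Q_measure" "(\<lambda>n. L2_norm Q_measure (\<lambda>z. zak_sum f (zint n) z - F z)) \<longlonglongrightarrow> 0"
  proof (rule L2_complete[of "\<lambda>n. zak_sum f (zint n)"])
    fix e :: real assume e: "0 < e"
    then have "\<forall>\<^sub>F n in sequentially. tail n < e / 2"
      by (intro order_tendstoD[OF tail0]) simp
    then obtain N where N: "tail N < e / 2"
      by (auto simp: eventually_sequentially)
    have "L2_norm Q_measure (\<lambda>z. zak_sum f (zint m) z - zak_sum f (zint n) z) \<le> e" if "m \<ge> N" "n \<ge> N" for m n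
      using L2_norm_diff_triangle[OF zak_L2[of "zint m"] zak_L2[of "zint N"] zak_L2[of "zint n"]]
        tail[OF finite_zint zint_mono[OF that(1)]] tail[OF finite_zint zint_mono[OF that(2)]] N
        L2_norm_minus_commute[of Q_measure "zak_sum f (zint N)" "zak_sum f (zint n)"]
      by linarith
    then show "\<exists>N. \<forall>m\<ge>N. \<forall>n\<ge>N. L2_norm Q_measure (\<lambda>z. zak_sum f (zint m) z - zak_sum f (zint n) z) \<le> e"
      by blast
  qed (use zak_L2 in auto)
  have "((\<lambda>A. L2_norm Q_measure (\<lambda>z. zak_sum f A z - F z)) \<longlongrightarrow> 0) (finite_subsets_at_top UNIV)"
  proof (rule tendstoI)
    fix e :: real assume e: "0 < e"
    have "(\<lambda>n. tail n + L2_norm Q_measure (\<lambda>z. zak_sum f (zint n) z - F z)) \<longlonglongrightarrow> 0"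
      using tendsto_add[OF tail0 F(2)] by simp
    then have "\<forall>\<^sub>F n in sequentially. tail n + L2_norm Q_measure (\<lambda>z. zak_sum f (zint n) z - F z) < e"
      using e by (intro order_tendstoD) auto
    then obtain n where n: "tail n + L2_norm Q_measure (\<lambda>z. zak_sum f (zint n) z - F z) < e"
      by (auto simp: eventually_sequentially)
    have "dist (L2_norm Q_measure (\<lambda>z. zak_sum f A z - F z)) 0 < e" if "finite A" "zint n \<subseteq> A" for A
      using L2_norm_diff_triangle[OF zak_L2[of A] zak_L2[of "zint n"] F(1)] tail[OF that] n
        L2_norm_nonneg[of Q_measure "\<lambda>z. zak_sum f A z - F z"] by simp
    then show "\<forall>\<^sub>F A in finite_subsets_at_top UNIV. dist (L2_norm Q_measure (\<lambda>z. zak_sum f A z - F z)) 0 < e"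
      unfolding eventually_finite_subsets_at_top by (intro exI[of _ "zint n"]) auto
  qed
  with F(1) have "is_zak f F" by (simp add: is_zak_def)
  then show ?thesis by (rule that)
qed

text \<open>The isometry of the Zak transform in polarized form, for any representatives: both sides
  are limits of the inner products of the partial sums over \<open>zint n\<close>.\<close>

lemma L2_inner_is_zak:
  assumes f: "f \<in> L2 lborel" "is_zak f F" and h: "h \<in> L2 lborel" "is_zak h H"
  shows "L2_inner Q_measure F H = L2_inner lborel f h"
proof (rule LIMSEQ_unique)
  show "(\<lambda>n. L2_inner Q_measure (zak_sum f (zint n)) (zak_sum h (zint n))) \<longlonglongrightarrow> L2_inner Q_measure F H"
    using f h by (intro L2_inner_tendsto L2_zak_sum is_zak_sequence) (auto simp: is_zak_def)
  note int = L2_mult_cnj_integrable[OF f(1) h(1)]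
  have "(\<lambda>n. LINT t|lborel. indicator (strip (zint n)) t *\<^sub>R (f t * cnj (h t))) \<longlonglongrightarrow> L2_inner lborel f h"
    unfolding L2_inner_def
  proof (rule integral_dominated_convergence[where w="\<lambda>t. cmod (f t * cnj (h t))"])
    show "AE t in lborel. (\<lambda>n. indicator (strip (zint n)) t *\<^sub>R (f t * cnj (h t))) \<longlonglongrightarrow> f t * cnj (h t)"
    proof (rule AE_I2)
      fix t
      have "(\<lambda>n. indicator (strip (zint n)) t *\<^sub>R (f t * cnj (h t))) \<longlonglongrightarrow> 1 *\<^sub>R (f t * cnj (h t))"
        by (intro tendsto_intros indicator_strip_zint_tendsto)
      then show "(\<lambda>n. indicator (strip (zint n)) t *\<^sub>R (f t * cnj (h t))) \<longlonglongrightarrow> f t * cnj (h t)"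
        by simp
    qed
    show "integrable lborel (\<lambda>t. cmod (f t * cnj (h t)))"
      using int by (rule integrable_norm)
    show "(\<lambda>t. f t * cnj (h t)) \<in> borel_measurable lborel"
      using int by (rule borel_measurable_integrable)
    show "(\<lambda>t. indicator (strip (zint n)) t *\<^sub>R (f t * cnj (h t))) \<in> borel_measurable lborel" for n
      by (rule borel_measurable_integrable) (intro integrable_mult_indicator int, simp)
    show "AE t in lborel. norm (indicator (strip (zint n)) t *\<^sub>R (f t * cnj (h t))) \<le> cmod (f t * cnj (h t))" for n
      by (auto simp: indicator_def)
  qed
  then show "(\<lambda>n. L2_inner Q_measure (zak_sum f (zint n)) (zak_sum h (zint n))) \<longlonglongrightarrow> L2_inner lborel f h"
    by (simp add: L2_inner_zak_sum f h)
qed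

lemma L2_norm_is_zak:
  assumes "f \<in> L2 lborel" "is_zak f F"
  shows "L2_norm Q_measure F = L2_norm lborel f"
proof -
  have "complex_of_real ((L2_norm Q_measure F)\<^sup>2) = complex_of_real ((L2_norm lborel f)\<^sup>2)"
    unfolding L2_inner_self[symmetric] by (rule L2_inner_is_zak[OF assms assms])
  then have "(L2_norm Q_measure F)\<^sup>2 = (L2_norm lborel f)\<^sup>2"
    by (simp only: of_real_eq_iff)
  then show ?thesis
    by (simp add: L2_norm_nonneg power2_eq_iff_nonneg)
qed

section \<open>The Zak transform of a Gabor system\<close>

lemma zak_sum_gabor:
  assumes "finite A"
  shows "zak_sum (gabor_system g (k, n)) A z =
    cis (2 * pi * of_int n * fst z) * cis (- 2 * pi * of_int k * snd z) * zak_sum g ((+) k ` A) z"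
proof -
  have "gabor_system g (k, n) (x - of_int j) * cis (2 * pi * of_int j * \<xi>) =
      cis (2 * pi * of_int n * x) * cis (- 2 * pi * of_int k * \<xi>) *
      (g (x - of_int (k + j)) * cis (2 * pi * of_int (k + j) * \<xi>))" for x \<xi> j
  proof -
    \<comment> \<open>An integer modulation does not see the integer shift by \<open>j\<close>,
      since \<open>n * j\<close> full turns are trivial.\<close>
    have "cis (2 * pi * of_int n * (x - of_int j)) = cis (2 * pi * of_int n * x) * cis (2 * pi * of_int (- n * j))"
      by (simp add: cis_mult algebra_simps)
    also have "cis (2 * pi * of_int (- n * j)) = 1"
      by (rule cis_multiple_2pi) simp
    finally have 1: "cis (2 * pi * of_int n * (x - of_int j)) = cis (2 * pi * of_int n * x)" by simp
    \<comment> \<open>The translation by \<open>k\<close> turns \<open>j\<close> into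
      \<open>k + j\<close>, which is paid for by a character in \<open>\<xi>\<close>.\<close>
    have 2: "cis (- 2 * pi * of_int k * \<xi>) * cis (2 * pi * of_int (k + j) * \<xi>) = cis (2 * pi * of_int j * \<xi>)"
      by (simp add: cis_mult algebra_simps)
    have "gabor_system g (k, n) (x - of_int j) = cis (2 * pi * of_int n * x) * g (x - of_int (k + j))"
      unfolding gabor_system_def modulation_def translation_def case_prod_conv 1
      by (simp add: algebra_simps)
    then show ?thesis
      unfolding 2[symmetric] by (simp only: mult_ac)
  qed
  then show ?thesis
    using assms
    by (cases z) (simp add: zak_sum_def sum_distrib_left sum.reindex)
qed

lemma is_zak_gabor:
  assumes G: "is_zak g G"
  shows "is_zak (gabor_system g (k, n)) (\<lambda>z. cis (2 * pi * of_int n * fst z) * cis (- 2 * pi * of_int k * snd z) * G z)"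
proof -
  let ?e = "\<lambda>z. cis (2 * pi * of_int n * fst z) * cis (- 2 * pi * of_int k * snd z)"
  have GL: "G \<in> L2 Q_measure" using G by (simp add: is_zak_def)
  have "(\<lambda>z. ?e z) \<in> borel_measurable Q_measure"
    by (intro borel_measurable_times cis_measurable borel_measurable_const
      measurable_compose[OF fst_snd_Q_measurable(1) id_U_measurable]
      measurable_compose[OF fst_snd_Q_measurable(2) id_U_measurable])
  then have "(\<lambda>z. ?e z * G z) \<in> L2 Q_measure"
    by (intro L2_bounded_mult[OF GL, where c=1]) (auto simp: norm_mult)
  moreover have "L2_norm Q_measure (\<lambda>z. zak_sum (gabor_system g (k, n)) A z - ?e z * G z) =
      L2_norm Q_measure (\<lambda>z. zak_sum g ((+) k ` A) z - G z)" if "finite A" for A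
    unfolding L2_norm_def zak_sum_gabor[OF that] right_diff_distrib[symmetric]
    by (simp add: norm_mult)
  then have "\<forall>\<^sub>F A in finite_subsets_at_top UNIV. L2_norm Q_measure (\<lambda>z. zak_sum g ((+) k ` A) z - G z) =
      L2_norm Q_measure (\<lambda>z. zak_sum (gabor_system g (k, n)) A z - ?e z * G z)"
    by (intro eventually_finite_subsets_at_top_weakI) simp
  \<comment> \<open>Translating all indices by \<open>k\<close> is cofinal on the net of finite
    sets, so the limit for \<open>g\<close> carries over.\<close>
  moreover have "filterlim (\<lambda>A. (+) k ` A) (finite_subsets_at_top UNIV) (finite_subsets_at_top UNIV)"
    unfolding filterlim_finite_subsets_at_top
  proof safe
    fix X :: "int set" assume X: "finite X"
    have "X \<subseteq> (+) k ` A" if "(\<lambda>j. j - k) ` X \<subseteq> A" for A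
      using image_mono[OF that, of "(+) k"] by (simp add: image_image)
    then show "\<forall>\<^sub>F A in finite_subsets_at_top UNIV. finite ((+) k ` A) \<and> X \<subseteq> (+) k ` A \<and> (+) k ` A \<subseteq> UNIV"
      unfolding eventually_finite_subsets_at_top using X
      by (intro exI[of _ "(\<lambda>j. j - k) ` X"]) auto
  qed
  then have "((\<lambda>A. L2_norm Q_measure (\<lambda>z. zak_sum g ((+) k ` A) z - G z)) \<longlongrightarrow> 0) (finite_subsets_at_top UNIV)"
    using G filterlim_compose unfolding is_zak_def by blast
  ultimately show ?thesis
    unfolding is_zak_def by (auto intro: Lim_transform_eventually)
qed

section \<open>Bessel's inequality and surjectivity of the Zak transform\<close>

lemma coef_Bessel:
  assumes q: "q \<in> L2 Q_measure" and A: "finite A"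
  shows "(\<Sum>j\<in>A. (L2_norm U_measure (coef q j))\<^sup>2) \<le> (L2_norm Q_measure q)\<^sup>2"
proof -
  let ?p = "trig_sum (coef q) A"
  let ?S = "\<Sum>j\<in>A. (L2_norm U_measure (coef q j))\<^sup>2"
  have p: "?p \<in> L2 Q_measure" using L2_coef[OF q] by (rule L2_trig_sum)
  \<comment> \<open>Both \<open><p, q>\<close> and \<open>||p||^2\<close> equal \<open>?S\<close>,
    so Cauchy-Schwarz gives \<open>||p||^2 \<le> ||p|| ||q||\<close>.\<close>
  have pq: "L2_inner Q_measure ?p q = of_real ?S"
    by (simp add: L2_inner_trig_sum_left[OF L2_coef[OF q] q] L2_inner_self)
  have "complex_of_real ((L2_norm Q_measure ?p)\<^sup>2) = of_real ?S"
    using L2_inner_trig_sum[where a="coef q" and b="coef q", OF A L2_coef[OF q] L2_coef[OF q]] by (simp add: L2_inner_self)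
  then have pp: "(L2_norm Q_measure ?p)\<^sup>2 = ?S"
    by (simp only: of_real_eq_iff)
  have "(L2_norm Q_measure ?p)\<^sup>2 \<le> L2_norm Q_measure ?p * L2_norm Q_measure q"
    using L2_Cauchy_Schwarz[OF p q] unfolding pq pp norm_of_real by (simp add: abs_of_nonneg sum_nonneg)
  then have "L2_norm Q_measure ?p \<le> L2_norm Q_measure q"
    using L2_norm_nonneg[of Q_measure ?p] L2_norm_nonneg[of Q_measure q]
    by (cases "L2_norm Q_measure ?p = 0") (auto simp: power2_eq_square)
  then show ?thesis
    unfolding pp[symmetric] by (intro power_mono L2_norm_nonneg)
qed

text \<open>Every \<open>t\<close> is \<open>x - j\<close> with \<open>x = frac t\<close> and
  \<open>j = - \<lfloor>t\<rfloor>\<close>; the value there is the one that the \<open>j\<close>-th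
  term of a Zak series for \<open>q\<close> must have.\<close>

definition inv_zak :: "(real \<times> real \<Rightarrow> complex) \<Rightarrow> real \<Rightarrow> complex" where
  "inv_zak q t = coef q (- \<lfloor>t\<rfloor>) (frac t)"

lemma inv_zak_shift:
  assumes "x \<in> {0..<1}"
  shows "inv_zak q (x - of_int j) = coef q j x"
proof -
  have "\<lfloor>x\<rfloor> = 0" using assms by (auto simp: floor_eq_iff)
  then show ?thesis by (simp add: inv_zak_def frac_def)
qed

lemma inv_zak_measurable:
  assumes "q \<in> borel_measurable Q_measure"
  shows "inv_zak q \<in> borel_measurable borel"
proof -
  have "frac \<in> borel \<rightarrow>\<^sub>M (borel :: real measure)"
    unfolding frac_def[abs_def] by measurable
  then have "frac \<in> borel \<rightarrow>\<^sub>M U_measure"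
    by (intro measurable_restrict_space2) (auto simp: frac_lt_1)
  then have "(\<lambda>t. coef q (- j) (frac t)) \<in> borel_measurable borel" for j
    using coef_measurable[OF assms] by (rule measurable_compose)
  then show ?thesis
    unfolding inv_zak_def[abs_def]
    by (rule measurable_compose_countable) (rule measurable_real_floor)
qed

text \<open>On finitely many unit intervals Bessel's inequality bounds the norm by that of
  \<open>q\<close>; Fatou's lemma removes the restriction.\<close>

lemma L2_inv_zak:
  assumes q: "q \<in> L2 Q_measure"
  shows "inv_zak q \<in> L2 lborel"
proof -
  let ?r = "inv_zak q" and ?N = "L2_norm Q_measure q"
  have [measurable]: "?r \<in> borel_measurable borel"
    using inv_zak_measurable L2_measurable[OF q] by blast
  define R where "R n t = indicator (strip (zint n)) t * ?r t" for n t
  have R_le: "R n \<in> L2 lborel \<and> L2_norm lborel (R n) \<le> ?N" for n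
  proof -
    have "(\<integral>\<^sup>+t. ennreal ((cmod (R n t))\<^sup>2) \<partial>lborel) =
        (\<integral>\<^sup>+t. indicator (strip (zint n)) t * ennreal ((cmod (?r t))\<^sup>2) \<partial>lborel)"
      by (rule nn_integral_cong) (simp add: R_def indicator_def)
    also have "\<dots> = (\<Sum>j\<in>zint n. \<integral>\<^sup>+x. ennreal ((cmod (?r (x - of_int j)))\<^sup>2) \<partial>U_measure)"
      by (rule nn_integral_strip) simp_all
    also have "\<dots> = (\<Sum>j\<in>zint n. \<integral>\<^sup>+x. ennreal ((cmod (coef q j x))\<^sup>2) \<partial>U_measure)"
      by (intro sum.cong refl nn_integral_cong) (simp add: inv_zak_shift)
    also have "\<dots> = ennreal (\<Sum>j\<in>zint n. (L2_norm U_measure (coef q j))\<^sup>2)"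
      by (simp add: nn_integral_L2 L2_coef q)
    also have "\<dots> \<le> ennreal (?N\<^sup>2)"
      by (intro ennreal_leI coef_Bessel q) simp
    finally have le: "(\<integral>\<^sup>+t. ennreal ((cmod (R n t))\<^sup>2) \<partial>lborel) \<le> ennreal (?N\<^sup>2)" .
    have "R n \<in> borel_measurable lborel"
      unfolding R_def[abs_def] by measurable
    from L2_nn_integralI[OF this le L2_norm_nonneg] show ?thesis by blast
  qed
  then have [measurable]: "R n \<in> borel_measurable borel" for n
    using L2_measurable[of "R n" lborel] by simp
  show ?thesis
  proof (rule L2_Fatou(1)[where F=R and N=0 and c="?N"])
    show "AE t in lborel. (\<lambda>n. R n t) \<longlonglongrightarrow> ?r t"
    proof (rule AE_I2)
      fix t
      have "(\<lambda>n. R n t) \<longlonglongrightarrow> 1 * ?r t"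
        unfolding R_def by (intro tendsto_intros indicator_strip_zint_tendsto)
      then show "(\<lambda>n. R n t) \<longlonglongrightarrow> ?r t" by simp
    qed
  qed (use R_le in simp_all)
qed

lemma L2_integrable_Q:
  assumes "q \<in> L2 Q_measure"
  shows "integrable Q_measure q"
proof -
  have "(\<lambda>z. 1) \<in> L2 Q_measure" by (simp add: L2_def)
  from L2_mult_cnj_integrable[OF assms this] show ?thesis by simp
qed

text \<open>Surjectivity of the Zak transform: the transform \<open>F\<close> of
  \<open>inv_zak q\<close> has the same Fourier coefficients on the torus as \<open>q\<close>, hence
  agrees with it almost everywhere.\<close>

lemma is_zak_inv_zak:
  assumes q: "q \<in> L2 Q_measure"
  shows "is_zak (inv_zak q) q"
proof -
  let ?r = "inv_zak q"
  have r: "?r \<in> L2 lborel" by (rule L2_inv_zak[OF q])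
  obtain F where F: "is_zak ?r F" using is_zak_exists[OF r] by blast
  then have FL: "F \<in> L2 Q_measure" by (simp add: is_zak_def)
  have "AE z in Q_measure. F z - q z = 0"
  proof (rule torus_Fourier_unique)
    show "integrable Q_measure (\<lambda>z. F z - q z)"
      by (intro L2_integrable_Q L2_diff FL q)
    fix m n
    \<comment> \<open>The signs are reversed since the inner product conjugates its second
      argument.\<close>
    let ?a = "\<lambda>x. cis (2 * pi * of_int (-m) * x)"
    let ?e = "\<lambda>z. ?a (fst z) * cis (2 * pi * of_int (-n) * snd z)"
    have e: "?e \<in> L2 Q_measure" by (intro L2_mult_fst_cis L2_cis_U)
    have inner_e: "L2_inner Q_measure p ?e = cnj (L2_inner U_measure ?a (coef p (- n)))" if "p \<in> L2 Q_measure" for p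
      using L2_inner_fst_cis[OF L2_cis_U[of "-m"] that, of "-n"] L2_inner_commute[of Q_measure p ?e] by simp
    have "L2_inner Q_measure F ?e = L2_inner Q_measure q ?e"
    proof (rule LIMSEQ_unique)
      show "(\<lambda>k. L2_inner Q_measure (zak_sum ?r (zint k)) ?e) \<longlonglongrightarrow> L2_inner Q_measure F ?e"
        using F FL e r by (intro L2_inner_tendsto L2_zak_sum is_zak_sequence) auto
      \<comment> \<open>Once \<open>-n\<close> is in \<open>zint k\<close>, the coefficient of the
        partial sum at \<open>-n\<close> is exactly that of \<open>q\<close>, so the sequence is
        eventually constant.\<close>
      have "\<forall>\<^sub>F k in sequentially. L2_inner Q_measure (zak_sum ?r (zint k)) ?e = L2_inner Q_measure q ?e"
        using eventually_in_zint[of "-n"]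
      proof eventually_elim
        case (elim k)
        have "coef (zak_sum ?r (zint k)) (- n) x = coef q (- n) x" if "x \<in> {0..<1}" for x
          using elim inv_zak_shift[OF that, of q "-n"] by (simp add: zak_sum_eq_trig_sum coef_trig_sum)
        then have "L2_inner U_measure ?a (coef (zak_sum ?r (zint k)) (- n)) = L2_inner U_measure ?a (coef q (- n))"
          unfolding L2_inner_def by (intro Bochner_Integration.integral_cong) auto
        then show ?case
          using inner_e[OF L2_zak_sum[OF r]] inner_e[OF q] by simp
      qed
      then show "(\<lambda>k. L2_inner Q_measure (zak_sum ?r (zint k)) ?e) \<longlonglongrightarrow> L2_inner Q_measure q ?e"
        by (rule tendsto_eventually)
    qed
    then have "L2_inner Q_measure (\<lambda>z. F z - q z) ?e = 0"
      unfolding L2_inner_diff_left[OF FL q e] by simp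
    then show "(LINT z|Q_measure. (F z - q z) * (cis (2 * pi * of_int m * fst z) * cis (2 * pi * of_int n * snd z))) = 0"
      by (simp add: L2_inner_def cis_cnj)
  qed
  then have AE: "AE z in Q_measure. F z = q z" by simp
  have "L2_norm Q_measure (\<lambda>z. zak_sum ?r A z - F z) = L2_norm Q_measure (\<lambda>z. zak_sum ?r A z - q z)" for A
    using L2_measurable[OF FL] L2_measurable[OF q] L2_measurable[OF L2_zak_sum[OF r]] AE
    by (intro L2_norm_cong_AE) auto
  then show ?thesis
    using F q by (simp add: is_zak_def)
qed

section \<open>Reproducing partners\<close>

text \<open>Only the term at \<open>p\<close> can be nonzero, so the partial sums are constant once
  the enumeration has passed \<open>p\<close>.\<close>

lemma sum_enumeration_delta_tendsto:
  fixes c :: "'i \<Rightarrow> complex"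
  assumes e: "bij (e :: nat \<Rightarrow> 'i)"
  shows "(\<lambda>N. \<Sum>k<N. c (e k) * (if e k = p then a else 0)) \<longlonglongrightarrow> c p * a"
proof (rule tendsto_eventually)
  obtain k0 where k0: "e k0 = p" using e by (metis bij_pointE)
  have eq: "e k = p \<longleftrightarrow> k = k0" for k
    using e k0 by (metis bij_is_inj injD)
  have "(\<Sum>k<N. c (e k) * (if e k = p then a else 0)) = c p * a" if "N > k0" for N
  proof -
    have "(\<Sum>k<N. c (e k) * (if e k = p then a else 0)) = (\<Sum>k<N. if k = k0 then c p * a else 0)"
      by (intro sum.cong) (auto simp: eq k0)
    then show ?thesis using that by simp
  qed
  then show "\<forall>\<^sub>F N in sequentially. (\<Sum>k<N. c (e k) * (if e k = p then a else 0)) = c p * a"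
    by (auto simp: eventually_sequentially intro!: exI[of _ "Suc k0"])
qed

text \<open>For fixed \<open>f\<close> the terms are bounded for every \<open>h\<close>, so uniform
  boundedness bounds the norms of \<open><f, \<psi> k> \<phi> k\<close>. The lower bound
  \<open>\<gamma>\<close> turns this into a bound on \<open><f, \<psi> k>\<close>, and uniform
  boundedness applies again.\<close>

lemma reproducing_pair_functionals_bounded:
  assumes \<psi>: "\<And>k. \<psi> k \<in> L2 M" and \<phi>: "\<And>k :: nat. \<phi> k \<in> L2 M"
    and \<gamma>: "\<And>k. L2_norm M (\<phi> k) \<ge> \<gamma>" "\<gamma> > 0"
    and conv: "\<And>f h. f \<in> L2 M \<Longrightarrow> h \<in> L2 M \<Longrightarrow>
      convergent (\<lambda>N. \<Sum>k<N. L2_inner M f (\<psi> k) * L2_inner M (\<phi> k) h)"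
  shows "\<exists>C. \<forall>k. L2_norm M (\<psi> k) \<le> C"
proof (rule L2_uniform_boundedness[OF \<psi>])
  fix f assume f: "f \<in> L2 M"
  have "\<exists>C. \<forall>k. L2_norm M (\<lambda>x. L2_inner M f (\<psi> k) * \<phi> k x) \<le> C"
  proof (rule L2_uniform_boundedness)
    fix h assume h: "h \<in> L2 M"
    have "summable (\<lambda>k. L2_inner M f (\<psi> k) * L2_inner M (\<phi> k) h)"
      using conv[OF f h] by (simp add: summable_iff_convergent)
    then have "Bseq (\<lambda>k. L2_inner M f (\<psi> k) * L2_inner M (\<phi> k) h)"
      by (intro convergent_imp_Bseq convergentI[of _ 0] summable_LIMSEQ_zero)
    then obtain C where "\<And>k. cmod (L2_inner M f (\<psi> k) * L2_inner M (\<phi> k) h) \<le> C"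
      by (auto simp: Bseq_def)
    moreover have "cmod (L2_inner M h (\<lambda>x. L2_inner M f (\<psi> k) * \<phi> k x)) =
        cmod (L2_inner M f (\<psi> k) * L2_inner M (\<phi> k) h)" for k
      by (simp add: L2_inner_cmult_right norm_mult L2_inner_commute[of M h])
    ultimately show "\<exists>C. \<forall>k. cmod (L2_inner M h (\<lambda>x. L2_inner M f (\<psi> k) * \<phi> k x)) \<le> C"
      by auto
  qed (intro L2_cmult \<phi>)
  then obtain C where C: "\<And>k. cmod (L2_inner M f (\<psi> k)) * L2_norm M (\<phi> k) \<le> C"
    by (auto simp: L2_norm_cmult)
  have "cmod (L2_inner M f (\<psi> k)) \<le> C / \<gamma>" for k
  proof -
    have "cmod (L2_inner M f (\<psi> k)) * \<gamma> \<le> C"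
      using C[of k] mult_left_mono[OF \<gamma>(1)[of k] norm_ge_zero[of "L2_inner M f (\<psi> k)"]] by linarith
    then show ?thesis using \<gamma>(2) by (simp add: field_simps)
  qed
  then show "\<exists>C. \<forall>k. cmod (L2_inner M f (\<psi> k)) \<le> C" by blast
qed

section \<open>Averages of powers and inner products with characters\<close>

lemma Cesaro_norm_power_minus_1:
  fixes w :: complex
  assumes w: "cmod w = 1" "w \<noteq> 1"
  shows "(\<lambda>N. (\<Sum>n<N. (cmod (w ^ n - 1))\<^sup>2) / real N) \<longlonglongrightarrow> 2"
proof -
  \<comment> \<open>On the unit circle \<open>|z - 1|^2 = 2 - 2 Re z\<close>, which reduces the
    claim to the averages of \<open>Re (w^n)\<close>.\<close>
  have sq: "(cmod (w ^ n - 1))\<^sup>2 = 2 - 2 * Re (w ^ n)" for n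
  proof -
    have "(Re (w ^ n))\<^sup>2 + (Im (w ^ n))\<^sup>2 = 1"
      using cmod_power2[of "w ^ n"] w by (simp add: norm_power)
    then show ?thesis
      unfolding cmod_power2[of "w ^ n - 1"] by (simp add: power2_diff)
  qed
  \<comment> \<open>The geometric sums stay bounded because \<open>w \<noteq> 1\<close>, so division
    by \<open>N\<close> sends them to \<open>0\<close>.\<close>
  have bound: "\<bar>\<Sum>n<N. Re (w ^ n)\<bar> \<le> 2 / cmod (w - 1)" for N
  proof -
    have "\<bar>\<Sum>n<N. Re (w ^ n)\<bar> = \<bar>Re (\<Sum>n<N. w ^ n)\<bar>" by simp
    also have "\<dots> \<le> cmod (\<Sum>n<N. w ^ n)" by (rule abs_Re_le_cmod)
    also have "\<dots> = cmod (w ^ N - 1) / cmod (w - 1)"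
      using w by (simp add: geometric_sum norm_divide)
    also have "\<dots> \<le> 2 / cmod (w - 1)"
      using norm_triangle_ineq4[of "w ^ N" 1] w by (intro divide_right_mono) (auto simp: norm_power)
    finally show ?thesis .
  qed
  have "(\<lambda>N. (\<Sum>n<N. Re (w ^ n)) / real N) \<longlonglongrightarrow> 0"
  proof (rule Lim_null_comparison)
    show "\<forall>\<^sub>F N in sequentially. norm ((\<Sum>n<N. Re (w ^ n)) / real N) \<le> 2 / cmod (w - 1) / real N"
      by (intro always_eventually allI)
         (simp only: real_norm_def abs_divide abs_of_nat, rule divide_right_mono[OF bound], simp)
    show "(\<lambda>N. 2 / cmod (w - 1) / real N) \<longlonglongrightarrow> 0"
      by (rule lim_const_over_n)
  qed
  then have "(\<lambda>N. 2 - 2 * ((\<Sum>n<N. Re (w ^ n)) / real N)) \<longlonglongrightarrow> 2 - 2 * 0"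
    by (intro tendsto_intros)
  \<comment> \<open>At \<open>N = 0\<close> the two sides differ, as \<open>x / 0\<close> is
    \<open>0\<close>.\<close>
  moreover have "\<forall>\<^sub>F N in sequentially. 2 - 2 * ((\<Sum>n<N. Re (w ^ n)) / real N) = (\<Sum>n<N. (cmod (w ^ n - 1))\<^sup>2) / real N"
    using eventually_gt_at_top[of 0]
    by eventually_elim (simp add: sq sum_subtractf sum_distrib_left[symmetric] field_simps)
  ultimately show ?thesis
    by (simp add: Lim_transform_eventually)
qed

lemma AE_Q_fst_neq: "AE z in Q_measure. fst z \<noteq> x0"
proof -
  have "AE z in (lborel :: (real \<times> real) measure). fst z \<noteq> x0"
  proof (rule AE_I')
    have "emeasure (lborel \<Otimes>\<^sub>M lborel) ({x0} \<times> (UNIV :: real set)) = emeasure lborel {x0} * emeasure lborel (UNIV :: real set)"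
      by (rule lborel.emeasure_pair_measure_Times) auto
    moreover have "{x0} \<times> (UNIV :: real set) \<in> sets borel"
      unfolding borel_prod[symmetric] by measurable
    ultimately show "{x0} \<times> UNIV \<in> null_sets (lborel :: (real \<times> real) measure)"
      by (simp add: lborel_prod null_sets_def)
  qed auto
  then show ?thesis
    by (subst AE_restrict_space_iff) auto
qed

text \<open>The second function depends on \<open>x\<close> only, so orthogonality in
  \<open>\<xi>\<close> forces \<open>k = 0\<close>; orthogonality in \<open>x\<close> then leaves
  its two frequencies \<open>n\<close> and \<open>0\<close>. For \<open>n = 0\<close> the
  contributions cancel.\<close>

lemma inner_character_Q:
  fixes k m n :: int
  shows "L2_inner Q_measure (\<lambda>z. cis (2 * pi * of_int m * fst z) * cis (- 2 * pi * of_int k * snd z))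
      (\<lambda>z. cis (2 * pi * of_int n * (fst z - x0)) - 1) =
    (if (k, m) = (0, n) then cis (2 * pi * of_int n * x0) else 0) - (if (k, m) = (0, 0) then 1 else 0)"
proof -
  let ?e = "\<lambda>n x. cis (2 * pi * of_int n * x)"
  let ?b = "\<lambda>x. cis (- 2 * pi * of_int n * x0) * ?e n x - 1"
  have L2_e: "?e j \<in> L2 U_measure" for j by (rule L2_cis_U)
  have L2_b: "?b \<in> L2 U_measure"
    using L2_diff[OF L2_cmult[OF L2_e[of n]] L2_e[of 0]] by simp
  have b: "(\<lambda>z. cis (2 * pi * of_int n * (fst z - x0)) - 1) = trig_sum (\<lambda>_. ?b) {0}"
    by (auto simp: trig_sum_def fun_eq_iff cis_mult algebra_simps)
  have inner_e: "L2_inner U_measure (?e m) (?e j) = (if m = j then 1 else 0)" for j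
  proof -
    have "L2_inner U_measure (?e m) (?e j) = (LINT x|U_measure. cis (2 * pi * of_int (m - j) * x))"
      unfolding L2_inner_def by (simp add: cis_cnj cis_mult algebra_simps)
    then show ?thesis unfolding integral_cis_U by simp
  qed
  have "L2_inner U_measure (?e m) ?b =
      cnj (cis (- 2 * pi * of_int n * x0)) * L2_inner U_measure (?e m) (?e n) - L2_inner U_measure (?e m) (?e 0)"
    using L2_inner_diff_right[OF L2_e L2_cmult[OF L2_e] L2_e, of m "cis (- 2 * pi * of_int n * x0)" n 0]
    by (simp add: L2_inner_cmult_right)
  then have inner_b: "L2_inner U_measure (?e m) ?b =
      (if m = n then cis (2 * pi * of_int n * x0) else 0) - (if m = 0 then 1 else 0)"
    unfolding inner_e by (simp add: cis_cnj)
  have "L2_inner Q_measure (\<lambda>z. ?e m (fst z) * cis (2 * pi * of_int (- k) * snd z)) (trig_sum (\<lambda>_. ?b) {0}) =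
      L2_inner U_measure (?e m) (coef (trig_sum (\<lambda>_. ?b) {0}) (- k))"
    by (rule L2_inner_fst_cis[OF L2_e L2_trig_sum[OF L2_b]])
  also have "coef (trig_sum (\<lambda>_. ?b) {0}) (- k) = (\<lambda>x. if k = 0 then ?b x else 0)"
    by (auto simp: coef_trig_sum fun_eq_iff)
  also have "L2_inner U_measure (?e m) \<dots> = (if k = 0 then L2_inner U_measure (?e m) ?b else 0)"
    by (simp add: L2_inner_def)
  finally show ?thesis
    unfolding b inner_b by (auto simp: prod_eq_iff)
qed

text \<open>A chord of the unit circle has length \<open>2 |sin (t/2)|\<close>.\<close>

lemma norm_cis_minus_1_le: "cmod (cis t - 1) \<le> \<bar>t\<bar>"
  using dist_exp_i_1[of t] abs_sin_x_le_abs_x[of "t / 2"] by (simp add: cis_conv_exp)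

section \<open>Nonexistence of a reproducing partner\<close>

theorem corollary4p3:
  fixes g :: "real \<Rightarrow> complex"
  assumes "g \<in> L2 lborel"
    and "\<not> quotient_in_L2 Q_measure (\<lambda>z. 1) (zak g)"
    and "\<exists>(x\<^sub>0, \<xi>\<^sub>0)\<in>Q. quotient_in_L2 Q_measure (\<lambda>z. of_real (rho (x\<^sub>0, \<xi>\<^sub>0) z)) (zak g)"
  shows "\<not> (\<exists>\<Psi> :: int \<times> int \<Rightarrow> real \<Rightarrow> complex.
            reproducing_pair lborel UNIV \<Psi> (gabor_system g))"
proof
  assume "\<exists>\<Psi> :: int \<times> int \<Rightarrow> real \<Rightarrow> complex. reproducing_pair lborel UNIV \<Psi> (gabor_system g)"
  then obtain \<Psi> :: "int \<times> int \<Rightarrow> real \<Rightarrow> complex" where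
    rp: "reproducing_pair lborel UNIV \<Psi> (gabor_system g)" ..
  have \<Psi>: "\<And>i. \<Psi> i \<in> L2 lborel" and \<Phi>: "\<And>i. gabor_system g i \<in> L2 lborel"
    using rp by (auto simp: reproducing_pair_def)
  \<comment> \<open>The index set is infinite, so the enumeration runs through all natural
    numbers.\<close>
  have dom: "enumeration_dom (UNIV :: (int \<times> int) set) = UNIV"
    by (simp add: enumeration_dom_def finite_prod)
  obtain e S where e: "bij (e :: nat \<Rightarrow> int \<times> int)"
    and conv': "\<forall>f\<in>L2 lborel. \<forall>h\<in>L2 lborel.
      (\<lambda>N. \<Sum>k<N. L2_inner lborel f (\<Psi> (e k)) * L2_inner lborel (gabor_system g (e k)) h)
        \<longlonglongrightarrow> L2_inner lborel (S f) h"
    and S: "L2_bounded_operator lborel S" and inv: "L2_boundedly_invertible lborel S"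
    using rp unfolding reproducing_pair_def dom Int_UNIV_right by blast
  have conv: "(\<lambda>N. \<Sum>k<N. L2_inner lborel f (\<Psi> (e k)) * L2_inner lborel (gabor_system g (e k)) h)
        \<longlonglongrightarrow> L2_inner lborel (S f) h" if "f \<in> L2 lborel" "h \<in> L2 lborel" for f h
    using conv' that by blast
  obtain T where T: "L2_bounded_operator lborel T"
    and ST: "\<And>f. f \<in> L2 lborel \<Longrightarrow> AE x in lborel. S (T f) x = f x"
    using inv unfolding L2_boundedly_invertible_def by blast
  define G where "G = zak g"
  have G: "is_zak g G"
    unfolding G_def zak_def using is_zak_exists[OF assms(1)] by (metis someI)
  then have GL: "G \<in> L2 Q_measure" by (simp add: is_zak_def)
  note [measurable] = L2_measurable[OF GL]
  obtain x0 \<xi>0 where rhoG: "quotient_in_L2 Q_measure (\<lambda>z. of_real (rho (x0, \<xi>0) z)) G"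
    and x0: "(x0, \<xi>0) \<in> Q"
    using assms(3) by (auto simp: G_def)
  have G0: "AE z in Q_measure. G z \<noteq> 0"
    and rL: "(\<lambda>z. of_real (rho (x0, \<xi>0) z) / G z) \<in> L2 Q_measure"
    using rhoG by (auto simp: quotient_in_L2_def)
  \<comment> \<open>\<open>G\<close> is nonzero almost everywhere and \<open>Q\<close> has measure
    \<open>1\<close>; this supplies the positive lower bound on the norms of the Gabor
    functions.\<close>
  have G_pos: "L2_norm Q_measure G > 0"
  proof (rule ccontr)
    assume "\<not> ?thesis"
    then have "(LINT z|Q_measure. (cmod (G z))\<^sup>2) = 0"
      using L2_norm_nonneg[of Q_measure G] by (simp add: L2_norm_power2[symmetric])
    then have "AE z in Q_measure. (cmod (G z))\<^sup>2 = 0"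
      by (subst (asm) integral_nonneg_eq_0_iff_AE) (auto simp: L2_integrable[OF GL])
    then have "AE z in Q_measure. False" using G0 by eventually_elim simp
    then have "emeasure Q_measure Q = 0"
      using AE_iff_measurable[of Q Q_measure "\<lambda>_. False"] sets.top[of Q_measure] by simp
    moreover have "emeasure Q_measure ({0..<1} \<times> {0..<1}) = 1"
      unfolding Q_measure_eq_pair
      by (subst U.emeasure_pair_measure_Times) (auto simp: emeasure_U sets_restrict_space_iff)
    ultimately show False by (simp add: Q_def)
  qed
  have gabor_norm: "L2_norm lborel (gabor_system g i) = L2_norm Q_measure G" for i
  proof -
    obtain k n where i: "i = (k, n)" by fastforce
    show ?thesis
      unfolding i L2_norm_is_zak[OF \<Phi> is_zak_gabor[OF G], symmetric] by (simp add: L2_norm_def norm_mult)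
  qed
  obtain C where C: "\<And>k. L2_norm lborel (\<Psi> (e k)) \<le> C"
    using reproducing_pair_functionals_bounded[of "\<lambda>k. \<Psi> (e k)" lborel "\<lambda>k. gabor_system g (e k)" "L2_norm Q_measure G"]
      \<Psi> \<Phi> gabor_norm G_pos convergentI[OF conv] by auto
  \<comment> \<open>The enumeration is onto, so the bound holds at every index.\<close>
  have C: "L2_norm lborel (\<Psi> i) \<le> C" for i
    using C[of "inv e i"] e by (simp add: bij_is_surj surj_f_inv_f)
  have C0: "0 \<le> C" using C[of "(0, 0)"] L2_norm_nonneg[of lborel "\<Psi> (0, 0)"] by linarith
  \<comment> \<open>A character in \<open>x\<close> alone, normalised to be \<open>1\<close> on the
    line \<open>x = x0\<close>.\<close>
  define E where "E n z = cis (2 * pi * of_nat n * (fst z - x0))" for n :: nat and z :: "real \<times> real"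
  have [measurable]: "(\<lambda>z. E n z) \<in> borel_measurable Q_measure" for n
    unfolding E_def
    by (intro cis_measurable borel_measurable_times borel_measurable_diff borel_measurable_const
        measurable_compose[OF fst_snd_Q_measurable(1) id_U_measurable])
  \<comment> \<open>The conjugate makes \<open>G\<close> cancel in \<open>G * cnj (q n)\<close>,
    leaving \<open>cnj (E n - 1)\<close>. On the null set \<open>G = 0\<close> the value is
    \<open>0\<close>.\<close>
  define q where "q n z = (E n z - 1) / cnj (G z)" for n z
  have q_meas [measurable]: "q n \<in> borel_measurable Q_measure" for n
    unfolding q_def[abs_def] by measurable
  have qL: "q n \<in> L2 Q_measure" for n
  proof -
    have "integrable Q_measure (\<lambda>z. (cmod (q n z))\<^sup>2)"
    proof (rule Bochner_Integration.integrable_bound)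
      show "integrable Q_measure (\<lambda>z. (2 * pi * n)\<^sup>2 * (cmod (of_real (rho (x0, \<xi>0) z) / G z))\<^sup>2)"
        using L2_integrable[OF rL] by simp
      \<comment> \<open>\<open>|E n - 1|\<close> is at most \<open>2 pi n |x - x0|\<close>, and
        \<open>|x - x0|\<close> at most the distance \<open>rho\<close>. The factor \<open>n\<close>
        is harmless, as only membership is claimed here.\<close>
      have "cmod (q n z) \<le> 2 * pi * n * cmod (of_real (rho (x0, \<xi>0) z) / G z)" for z
      proof -
        have "cmod (E n z - 1) \<le> \<bar>2 * pi * n * (fst z - x0)\<bar>"
          unfolding E_def by (rule norm_cis_minus_1_le)
        also have "\<dots> = 2 * pi * n * \<bar>fst z - x0\<bar>"
          by (simp add: abs_mult)
        also have "\<dots> \<le> 2 * pi * n * rho (x0, \<xi>0) z"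
          by (intro mult_left_mono) (auto simp: rho_def split: prod.split intro!: real_le_rsqrt)
        finally have "cmod (E n z - 1) / cmod (G z) \<le> 2 * pi * n * rho (x0, \<xi>0) z / cmod (G z)"
          by (rule divide_right_mono) simp
        moreover have "0 \<le> rho (x0, \<xi>0) z"
          by (simp add: rho_def split: prod.split)
        ultimately show ?thesis by (simp add: q_def norm_divide)
      qed
      then have "(cmod (q n z))\<^sup>2 \<le> (2 * pi * n * cmod (of_real (rho (x0, \<xi>0) z) / G z))\<^sup>2" for z
        by (intro power_mono) auto
      then show "AE z in Q_measure. norm ((cmod (q n z))\<^sup>2) \<le>
          norm ((2 * pi * n)\<^sup>2 * (cmod (of_real (rho (x0, \<xi>0) z) / G z))\<^sup>2)"
        by (simp add: power_mult_distrib)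
    qed measurable
    then show ?thesis using q_meas by (simp add: L2_def)
  qed
  define h where "h n = inv_zak (q n)" for n
  have hL: "h n \<in> L2 lborel" and hz: "is_zak (h n) (q n)" for n
    using L2_inv_zak[OF qL] is_zak_inv_zak[OF qL] by (auto simp: h_def)
  have h_norm: "L2_norm Q_measure (q n) = L2_norm lborel (h n)" for n
    by (rule L2_norm_is_zak[OF hL hz])
  \<comment> \<open>The isometry moves the inner product to \<open>Q\<close>, where \<open>G\<close>
    cancels and only inner products of characters remain.\<close>
  have inner_h: "L2_inner lborel (gabor_system g i) (h n) =
      (if i = (0, int n) then cis (2 * pi * of_nat n * x0) else 0) - (if i = (0, 0) then 1 else 0)" for i n
  proof -
    obtain k m where i: "i = (k, m)" by fastforce
    let ?c = "\<lambda>z. cis (2 * pi * of_int m * fst z) * cis (- 2 * pi * of_int k * snd z)"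
    have [measurable]: "?c \<in> borel_measurable Q_measure"
      by (intro borel_measurable_times cis_measurable borel_measurable_const
        measurable_compose[OF fst_snd_Q_measurable(1) id_U_measurable]
        measurable_compose[OF fst_snd_Q_measurable(2) id_U_measurable])
    have "L2_inner lborel (gabor_system g i) (h n) = L2_inner Q_measure (\<lambda>z. ?c z * G z) (q n)"
      unfolding i by (rule L2_inner_is_zak[OF \<Phi> is_zak_gabor[OF G] hL hz, symmetric])
    also have "\<dots> = L2_inner Q_measure ?c (\<lambda>z. E n z - 1)"
      unfolding L2_inner_def
    proof (rule integral_cong_AE)
      show "AE z in Q_measure. ?c z * G z * cnj (q n z) = ?c z * cnj (E n z - 1)"
        using G0 by eventually_elim (simp add: q_def)
    qed measurable
    also have "\<dots> = (if i = (0, int n) then cis (2 * pi * of_nat n * x0) else 0) - (if i = (0, 0) then 1 else 0)"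
      using inner_character_Q[of m k "int n" x0] by (simp add: i E_def)
    finally show ?thesis .
  qed
  \<comment> \<open>For \<open>n = 0\<close> both surviving terms sit at the same index and cancel,
    in accordance with \<open>q 0 = 0\<close>.\<close>
  have S_h: "L2_inner lborel (S f) (h n) =
      L2_inner lborel f (\<Psi> (0, int n)) * cis (2 * pi * of_nat n * x0) - L2_inner lborel f (\<Psi> (0, 0))"
    if f: "f \<in> L2 lborel" for f n
  proof (rule LIMSEQ_unique[OF conv[OF f hL]])
    let ?c = "\<lambda>i. L2_inner lborel f (\<Psi> i)"
    have "(\<lambda>N. (\<Sum>k<N. ?c (e k) * (if e k = (0, int n) then cis (2 * pi * of_nat n * x0) else 0)) -
        (\<Sum>k<N. ?c (e k) * (if e k = (0, 0) then 1 else 0)))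
        \<longlonglongrightarrow> ?c (0, int n) * cis (2 * pi * of_nat n * x0) - ?c (0, 0) * 1"
      by (intro tendsto_diff sum_enumeration_delta_tendsto e)
    then show "(\<lambda>N. \<Sum>k<N. ?c (e k) * L2_inner lborel (gabor_system g (e k)) (h n)) \<longlonglongrightarrow>
        ?c (0, int n) * cis (2 * pi * of_nat n * x0) - ?c (0, 0)"
      unfolding inner_h right_diff_distrib sum_subtractf by simp
  qed
  obtain K where K: "\<And>f. f \<in> L2 lborel \<Longrightarrow> T f \<in> L2 lborel"
    "\<And>f. f \<in> L2 lborel \<Longrightarrow> L2_norm lborel (T f) \<le> K * L2_norm lborel f"
    using T unfolding L2_bounded_operator_def by blast
  \<comment> \<open>The absolute value makes \<open>B\<close> nonnegative whatever the sign of
    \<open>K\<close>.\<close>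
  define B where "B = \<bar>2 * C * K\<bar>"
  have q_le: "L2_norm Q_measure (q n) \<le> B" for n
  proof -
    let ?f = "T (h n)" and ?\<nu> = "L2_norm lborel (h n)"
    have f: "?f \<in> L2 lborel" by (rule K(1)[OF hL])
    have "S ?f \<in> L2 lborel" using S f by (simp add: L2_bounded_operator_def)
    \<comment> \<open>\<open>T\<close> inverts \<open>S\<close> almost everywhere, so
      \<open><S ?f, h n>\<close> is the squared norm of \<open>h n\<close>.\<close>
    then have "L2_inner lborel (S ?f) (h n) = L2_inner lborel (h n) (h n)"
      using L2_measurable[OF hL] by (intro L2_inner_cong_AE L2_measurable ST hL) auto
    then have "of_real (?\<nu>\<^sup>2) = L2_inner lborel ?f (\<Psi> (0, int n)) * cis (2 * pi * of_nat n * x0) - L2_inner lborel ?f (\<Psi> (0, 0))"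
      using S_h[OF f, of n] by (simp only: L2_inner_self)
    then have "cmod (of_real (?\<nu>\<^sup>2)) \<le> cmod (L2_inner lborel ?f (\<Psi> (0, int n))) + cmod (L2_inner lborel ?f (\<Psi> (0, 0)))"
      by (metis norm_triangle_ineq4 norm_mult norm_cis mult_1_right)
    moreover have "cmod (L2_inner lborel ?f (\<Psi> i)) \<le> K * ?\<nu> * C" for i
    proof -
      have "L2_norm lborel ?f * L2_norm lborel (\<Psi> i) \<le> K * ?\<nu> * C"
        using K(2)[OF hL[of n]] L2_norm_nonneg[of lborel ?f]
        by (intro mult_mono C L2_norm_nonneg) linarith+
      then show ?thesis using L2_Cauchy_Schwarz[OF f \<Psi>[of i]] by linarith
    qed
    ultimately have "?\<nu>\<^sup>2 \<le> K * ?\<nu> * C + K * ?\<nu> * C"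
      by (smt (verit) norm_of_real zero_le_power2)
    then have "?\<nu> * ?\<nu> \<le> ?\<nu> * (2 * C * K)"
      by (simp add: power2_eq_square algebra_simps)
    \<comment> \<open>Cancelling one factor of the norm leaves a bound free of \<open>n\<close>; a
      zero norm is below \<open>B\<close> anyway.\<close>
    then have "?\<nu> \<le> B"
      using L2_norm_nonneg[of lborel "h n"] by (cases "?\<nu> = 0") (auto simp: B_def)
    then show ?thesis by (simp add: h_norm)
  qed
  \<comment> \<open>The quadratic mean of \<open>|q 0|, ..., |q (N-1)|\<close>: its squared norm is
    the average of the squared norms of the \<open>q n\<close>, hence at most
    \<open>B^2\<close>.\<close>
  define F where "F N z = complex_of_real (sqrt ((\<Sum>n<N. (cmod (q n z))\<^sup>2) / real N))" for N z
  have FL: "F N \<in> L2 Q_measure \<and> L2_norm Q_measure (F N) \<le> B" if N: "N \<ge> 1" for N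
  proof -
    have F2: "(cmod (F N z))\<^sup>2 = (\<Sum>n<N. (cmod (q n z))\<^sup>2) / real N" for z
      by (simp add: F_def sum_nonneg)
    have "F N \<in> borel_measurable Q_measure"
      unfolding F_def[abs_def] by measurable
    moreover have "integrable Q_measure (\<lambda>z. (cmod (F N z))\<^sup>2)"
      unfolding F2 using L2_integrable[OF qL] by simp
    ultimately have "F N \<in> L2 Q_measure" by (simp add: L2_def)
    moreover have "(L2_norm Q_measure (F N))\<^sup>2 = (\<Sum>n<N. (L2_norm Q_measure (q n))\<^sup>2) / real N"
      unfolding L2_norm_power2 F2 using L2_integrable[OF qL] by simp
    moreover have "\<dots> \<le> (\<Sum>n<N. B\<^sup>2) / real N"
      by (intro divide_right_mono sum_mono power_mono q_le L2_norm_nonneg) simp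
    ultimately show ?thesis
      using N power2_le_imp_le[of "L2_norm Q_measure (F N)" B] by (simp add: B_def)
  qed
  \<comment> \<open>The averages of \<open>|q n|^2\<close> are those of \<open>|E n - 1|^2\<close>
    divided by \<open>|G|^2\<close>, and the averages of \<open>|E n - 1|^2\<close> tend to
    \<open>2\<close> off the null line \<open>x = x0\<close>. At zeros of \<open>G\<close> both
    sides are \<open>0\<close> by convention.\<close>
  have "AE z in Q_measure. (\<lambda>N. F N z) \<longlonglongrightarrow> complex_of_real (sqrt (2 / (cmod (G z))\<^sup>2))"
    using AE_Q_fst_neq[of x0] AE_space
  proof eventually_elim
    case (elim z)
    let ?w = "cis (2 * pi * (fst z - x0))"
    \<comment> \<open>Both \<open>fst z\<close> and \<open>x0\<close> lie in \<open>[0, 1)\<close>,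
      where \<open>cis (2 * pi * x)\<close> is injective in \<open>x\<close>.\<close>
    have "?w \<noteq> 1"
    proof
      assume "?w = 1"
      then have "cis (2 * pi * fst z) / cis (2 * pi * x0) = 1"
        by (simp add: cis_divide right_diff_distrib)
      then have "cis (2 * pi * fst z) = cis (2 * pi * x0)" by simp
      then have "fst z = x0"
        using elim(2)[unfolded space_Q] x0 by (intro cis_2pi_inj) (auto simp: Q_def)
      with elim(1) show False by simp
    qed
    moreover have "E n z = ?w ^ n" for n
      unfolding E_def Complex.DeMoivre by (simp add: mult_ac)
    ultimately have lim: "(\<lambda>N. (\<Sum>n<N. (cmod (E n z - 1))\<^sup>2) / real N) \<longlonglongrightarrow> 2"
      using Cesaro_norm_power_minus_1[of ?w] by (simp only: norm_cis not_False_eq_True simp_thms)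
    have "(\<Sum>n<N. (cmod (q n z))\<^sup>2) / real N = (\<Sum>n<N. (cmod (E n z - 1))\<^sup>2) / real N / (cmod (G z))\<^sup>2" for N
      by (simp add: q_def norm_divide power_divide sum_divide_distrib mult.commute)
    moreover have "(\<lambda>N. (\<Sum>n<N. (cmod (E n z - 1))\<^sup>2) / real N / (cmod (G z))\<^sup>2) \<longlonglongrightarrow> 2 / (cmod (G z))\<^sup>2"
      unfolding divide_inverse[of _ "(cmod (G z))\<^sup>2"] by (intro tendsto_mult lim tendsto_const)
    ultimately have "(\<lambda>N. (\<Sum>n<N. (cmod (q n z))\<^sup>2) / real N) \<longlonglongrightarrow> 2 / (cmod (G z))\<^sup>2"
      by (simp only:)
    then show ?case
      unfolding F_def by (intro tendsto_of_real tendsto_real_sqrt)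
  qed
  moreover have "F N \<in> borel_measurable Q_measure" for N
    unfolding F_def[abs_def] by measurable
  moreover have "(\<lambda>z. complex_of_real (sqrt (2 / (cmod (G z))\<^sup>2))) \<in> borel_measurable Q_measure"
    by measurable
  ultimately have "(\<lambda>z. complex_of_real (sqrt (2 / (cmod (G z))\<^sup>2))) \<in> L2 Q_measure"
    using L2_Fatou(1)[of F Q_measure _ 1 B] FL by blast
  then have "integrable Q_measure (\<lambda>z. (cmod (complex_of_real (sqrt (2 / (cmod (G z))\<^sup>2))))\<^sup>2)"
    by (rule L2_integrable)
  then have "integrable Q_measure (\<lambda>z. 2 * (cmod (1 / G z))\<^sup>2)"
    by (simp add: norm_divide power_divide)
  then have "(\<lambda>z. 1 / G z) \<in> L2 Q_measure"
    by (simp add: L2_def)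
  then have "quotient_in_L2 Q_measure (\<lambda>z. 1) G"
    using G0 by (simp add: quotient_in_L2_def)
  with assms(2) show False by (simp add: G_def)
qed

end
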